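(* Let $V$ be a right quaternionic Hilbert space and $A\in\mathcal B(V)$. Then the generalized Kato S-spectrum $\sigma_{gk}^S(A)$ and the essentially semi-regular S-spectrum $\sigma_{es}^S(A)$ are compact subsets of the S-spectrum $\sigma_S(A)$. Moreover, $\sigma_{ka}^S(A)\setminus\sigma_{gk}^S(A)$ and $\sigma_{es}^S(A)\setminus\sigma_{gk}^S(A)$ each consist of at most countably many isolated points.
   Context: $\mathbb H$ denotes the quaternions. A right quaternionic Hilbert space $V$ is a right $\mathbb H$-vector space with an $\mathbb H$-valued inner product satisfying $\overline{\langle\phi|\psi\rangle}=\langle\psi|\phi\rangle$, additivity, $\langle\phi|\psi\mathfrak q\rangle=\langle\phi|\psi\rangle\mathfrak q$, $\langle\phi\mathfrak q|\psi\rangle=\overline{\mathfrak q}\langle\phi|\psi\rangle$ and $\|\phi\|^2=\langle\phi|\phi\rangle>0$ for $\phi\ne0$, complete in this norm and separable. $\mathcal B(V)$ is the set of bounded right $\mathbb H$-linear operators $V\to V$. For $\mathfrak q\in\mathbb H$, $R_{\mathfrak q}(A)=A^2-2\,\mathrm{Re}(\mathfrak q)A+|\mathfrak q|^2 I$, and $\sigma_S(A)=\{\mathfrak q: R_{\mathfrak q}(A)\text{ has no inverse in }\mathcal B(V)\}$. An operator $B$ is semi-regular if $\mathrm{ran}(B)$ is closed and $\ker(B)\subseteq\bigcap_{n\in\mathbb N}\mathrm{ran}(B^n)$; it is quasi-nilpotent if $\lim_{n\to\infty}\|B^n\|^{1/n}=0$. A generalized Kato decomposition (GKD) of $B\in\mathcal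 B(V)$ is a pair $(M,N)$ of closed $B$-invariant right linear subspaces of $V$ with $V=M\oplus N$, $B|_M$ semi-regular and $B|_N$ quasi-nilpotent ($M$ or $N$ may be $\{0\}$). $B$ is of Kato type if it admits a GKD $(M,N)$ with $(B|_N)^d=0$ for some $d\in\mathbb N$. $B$ is essentially semi-regular if it admits a GKD $(M,N)$ with $N$ finite dimensional. The Kato S-spectrum is $\sigma_{ka}^S(A)=\{\mathfrak q\in\mathbb H: R_{\mathfrak q}(A)\text{ is not semi-regular}\}$. Further, $\sigma_{gk}^S(A)=\{\mathfrak q\in\mathbb H: R_{\mathfrak q}(A)\text{ is not of Kato type}\}$ and $\sigma_{es}^S(A)=\{\mathfrak q\in\mathbb H: R_{\mathfrak q}(A)\text{ is not essentially semi-regular}\}$.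
   Formalization: "Countably many isolated points" is false for non-real points (V = H, Ax = ix gives a whole 2-sphere); it is proved for similarity classes [q] = {p : Re p = Re q, |p| = |q|}: countably many, each isolated as a set in the Kato resp. essentially semi-regular S-spectrum. *)

theory Defs
  imports "HOL-Analysis.Analysis"
begin

section \<open>Quaternions\<close>

datatype quat = Quat (qRe: real) (qI: real) (qJ: real) (qK: real)

lemma quat_eq_iff: "p = q \<longleftrightarrow> qRe p = qRe q \<and> qI p = qI q \<and> qJ p = qJ q \<and> qK p = qK q"
  by (cases p; cases q) auto

lemma quat_eqI: "\<lbrakk>qRe p = qRe q; qI p = qI q; qJ p = qJ q; qK p = qK q\<rbrakk> \<Longrightarrow> p = q"
  by (simp add: quat_eq_iff)

instantiation quat :: real_vector
begin

definition "0 = Quat 0 0 0 0"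
definition "p + q = Quat (qRe p + qRe q) (qI p + qI q) (qJ p + qJ q) (qK p + qK q)"
definition "- p = Quat (- qRe p) (- qI p) (- qJ p) (- qK p)"
definition "p - q = Quat (qRe p - qRe q) (qI p - qI q) (qJ p - qJ q) (qK p - qK q)"
definition "r *\<^sub>R p = Quat (r * qRe p) (r * qI p) (r * qJ p) (r * qK p)"

instance
  by standard
    (auto simp: zero_quat_def plus_quat_def uminus_quat_def minus_quat_def scaleR_quat_def
      algebra_simps)

end

instantiation quat :: real_inner
begin

definition "inner p q = qRe p * qRe q + qI p * qI q + qJ p * qJ q + qK p * qK q"
definition "norm p = sqrt ((qRe p)\<^sup>2 + (qI p)\<^sup>2 + (qJ p)\<^sup>2 + (qK p)\<^sup>2)"
definition "sgn (p::quat) = p /\<^sub>R norm p"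
definition "dist (p::quat) q = norm (p - q)"
definition [code del]:
  "(uniformity :: (quat \<times> quat) filter) = (INF e\<in>{0 <..}. principal {(p, q). dist p q < e})"
definition [code del]:
  "open (U :: quat set) \<longleftrightarrow> (\<forall>p\<in>U. eventually (\<lambda>(p', q). p' = p \<longrightarrow> q \<in> U) uniformity)"

instance
proof
  fix p q r :: quat and a :: real
  show "dist p q = norm (p - q)" by (rule dist_quat_def)
  show "sgn p = p /\<^sub>R norm p" by (rule sgn_quat_def)
  show "uniformity = (INF e\<in>{0 <..}. principal {(p::quat, q). dist p q < e})"
    by (rule uniformity_quat_def)
  show "open U \<longleftrightarrow> (\<forall>p\<in>U. eventually (\<lambda>(p', q). p' = p \<longrightarrow> q \<in> U) uniformity)"
    for U :: "quat set" by (rule open_quat_def)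
  show "inner p q = inner q p" by (simp add: inner_quat_def)
  show "inner (p + q) r = inner p r + inner q r"
    by (simp add: inner_quat_def plus_quat_def algebra_simps)
  show "inner (a *\<^sub>R p) q = a * inner p q"
    by (simp add: inner_quat_def scaleR_quat_def algebra_simps)
  show "0 \<le> inner p p" by (simp add: inner_quat_def)
  show "inner p p = 0 \<longleftrightarrow> p = 0"
    by (simp add: inner_quat_def zero_quat_def quat_eq_iff add_nonneg_eq_0_iff)
  show "norm p = sqrt (inner p p)"
    by (simp add: inner_quat_def norm_quat_def power2_eq_square)
qed

end

instantiation quat :: real_normed_div_algebra
begin

definition "1 = Quat 1 0 0 0"
definition "p * q = Quat
  (qRe p * qRe q - qI p * qI q - qJ p * qJ q - qK p * qK q)
  (qRe p * qI q + qI p * qRe q + qJ p * qK q - qK p * qJ q)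
  (qRe p * qJ q - qI p * qK q + qJ p * qRe q + qK p * qI q)
  (qRe p * qK q + qI p * qJ q - qJ p * qI q + qK p * qRe q)"
definition "inverse p =
  Quat (qRe p) (- qI p) (- qJ p) (- qK p)
    /\<^sub>R ((qRe p)\<^sup>2 + (qI p)\<^sup>2 + (qJ p)\<^sup>2 + (qK p)\<^sup>2)"
definition "p div q = p * inverse (q::quat)"

instance
proof
  fix p q r :: quat and a :: real
  show "p * q * r = p * (q * r)" by (simp add: times_quat_def algebra_simps)
  show "1 * p = p" "p * 1 = p" by (simp_all add: times_quat_def one_quat_def)
  show "(p + q) * r = p * r + q * r" "p * (q + r) = p * q + p * r"
    by (simp_all add: times_quat_def plus_quat_def algebra_simps)
  show "a *\<^sub>R p * q = a *\<^sub>R (p * q)" "p * a *\<^sub>R q = a *\<^sub>R (p * q)"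
    by (simp_all add: times_quat_def scaleR_quat_def algebra_simps)
  show "(0::quat) \<noteq> 1" by (simp add: zero_quat_def one_quat_def)
  show "p div q = p * inverse q" by (rule divide_quat_def)
  show "inverse (0::quat) = 0" by (simp add: inverse_quat_def zero_quat_def scaleR_quat_def)
  show "norm (p * q) = norm p * norm q"
    unfolding norm_quat_def real_sqrt_mult[symmetric]
    by (simp add: times_quat_def power2_eq_square algebra_simps)
  {
    assume "p \<noteq> 0"
    define s where "s = (qRe p)\<^sup>2 + (qI p)\<^sup>2 + (qJ p)\<^sup>2 + (qK p)\<^sup>2"
    have "s \<noteq> 0"
      using \<open>p \<noteq> 0\<close> by (simp add: s_def zero_quat_def quat_eq_iff add_nonneg_eq_0_iff)
    moreover have s: "qRe p * qRe p + (qI p * qI p + (qJ p * qJ p + qK p * qK p)) = s"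
      by (simp add: s_def power2_eq_square)
    ultimately show "inverse p * p = 1" "p * inverse p = 1"
      unfolding inverse_quat_def s_def[symmetric]
      by (auto simp: times_quat_def one_quat_def scaleR_quat_def field_simps power2_eq_square s)
  }
qed

end

definition qcnj :: "quat \<Rightarrow> quat" where
  "qcnj q = Quat (qRe q) (- qI q) (- qJ q) (- qK q)"

text \<open>The class \<open>[q]\<close> of all quaternions similar to \<open>q\<close>, i.e. those with the same real part and
  the same modulus: the singleton \<open>{q}\<close> if \<open>q\<close> is real, a 2-sphere otherwise.\<close>

definition qsphere :: "quat \<Rightarrow> quat set" where
  "qsphere q = {p. qRe p = qRe q \<and> norm p = norm q}"


section \<open>Right quaternionic Hilbert spaces\<close>

text \<open>The underlying real Banach space is part of the class; \<open>scaleH_of_real\<close> and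
  \<open>hinner_self\<close> say that its real scalar multiplication and its norm are the ones induced by the
  quaternionic structure.\<close>

class right_quat_hilbert = banach +
  fixes scaleH :: "'a \<Rightarrow> quat \<Rightarrow> 'a" (infixl \<open>\<cdot>\<^sub>H\<close> 75)
    and hinner :: "'a \<Rightarrow> 'a \<Rightarrow> quat"
  assumes scaleH_add_left: "(x + y) \<cdot>\<^sub>H p = x \<cdot>\<^sub>H p + y \<cdot>\<^sub>H p"
    and scaleH_add_right: "x \<cdot>\<^sub>H (p + q) = x \<cdot>\<^sub>H p + x \<cdot>\<^sub>H q"
    and scaleH_scaleH: "x \<cdot>\<^sub>H p \<cdot>\<^sub>H q = x \<cdot>\<^sub>H (p * q)"
    and scaleH_of_real: "x \<cdot>\<^sub>H of_real r = r *\<^sub>R x"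
    and hinner_cnj: "qcnj (hinner x y) = hinner y x"
    and hinner_add_right: "hinner x (y + z) = hinner x y + hinner x z"
    and hinner_scaleH_right: "hinner x (y \<cdot>\<^sub>H q) = hinner x y * q"
    and hinner_scaleH_left: "hinner (x \<cdot>\<^sub>H q) y = qcnj q * hinner x y"
    and hinner_self: "hinner x x = of_real ((norm x)\<^sup>2)"
    and separable: "\<exists>D::'a set. countable D \<and> (\<forall>x. \<forall>e>0. \<exists>y\<in>D. dist x y < e)"

definition bounded_right_linear :: "('a::right_quat_hilbert \<Rightarrow> 'a) \<Rightarrow> bool" where
  "bounded_right_linear A \<longleftrightarrow> bounded_linear A \<and> (\<forall>x q. A (x \<cdot>\<^sub>H q) = A x \<cdot>\<^sub>H q)"

definition right_subspace :: "'a::right_quat_hilbert set \<Rightarrow> bool" where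
  "right_subspace M \<longleftrightarrow>
     0 \<in> M \<and> (\<forall>x\<in>M. \<forall>y\<in>M. x + y \<in> M) \<and> (\<forall>x\<in>M. \<forall>q. x \<cdot>\<^sub>H q \<in> M)"

definition right_finite_dim :: "'a::right_quat_hilbert set \<Rightarrow> bool" where
  "right_finite_dim N \<longleftrightarrow> (\<exists>S. finite S \<and> N = right_subspace hull S)"


section \<open>Generalized Kato decompositions\<close>

text \<open>For a \<open>B\<close>-invariant subspace \<open>M\<close>, the restriction of \<open>B\<close> to \<open>M\<close> is represented by the pair of
  \<open>M\<close> and \<open>B\<close>. Since \<open>M\<close> will be closed, a subset of \<open>M\<close> is closed in \<open>M\<close> iff it is closed in the
  whole space.\<close>

definition semi_regular_on :: "'a::right_quat_hilbert set \<Rightarrow> ('a \<Rightarrow> 'a) \<Rightarrow> bool" where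
  "semi_regular_on M B \<longleftrightarrow> closed (B ` M) \<and> {x\<in>M. B x = 0} \<subseteq> (\<Inter>n. (B ^^ n) ` M)"

abbreviation semi_regular :: "('a::right_quat_hilbert \<Rightarrow> 'a) \<Rightarrow> bool" where
  "semi_regular B \<equiv> semi_regular_on UNIV B"

text \<open>Operator norm of the restriction, in the style of \<^const>\<open>onorm\<close>; it is \<open>0\<close> for \<open>N = {0}\<close>
  because \<open>0 / 0 = 0\<close>.\<close>

definition onorm_on :: "'a::right_quat_hilbert set \<Rightarrow> ('a \<Rightarrow> 'a) \<Rightarrow> real" where
  "onorm_on N B = (SUP x\<in>N. norm (B x) / norm x)"

definition quasi_nilpotent_on :: "'a::right_quat_hilbert set \<Rightarrow> ('a \<Rightarrow> 'a) \<Rightarrow> bool" where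
  "quasi_nilpotent_on N B \<longleftrightarrow> (\<lambda>n. root n (onorm_on N (B ^^ n))) \<longlonglongrightarrow> 0"

definition is_GKD ::
    "('a::right_quat_hilbert \<Rightarrow> 'a) \<Rightarrow> 'a set \<Rightarrow> 'a set \<Rightarrow> bool" where
  "is_GKD B M N \<longleftrightarrow>
     right_subspace M \<and> closed M \<and> B ` M \<subseteq> M \<and>
     right_subspace N \<and> closed N \<and> B ` N \<subseteq> N \<and>
     M \<inter> N = {0} \<and> (\<forall>x. \<exists>m\<in>M. \<exists>n\<in>N. x = m + n) \<and>
     semi_regular_on M B \<and> quasi_nilpotent_on N B"

definition kato_type :: "('a::right_quat_hilbert \<Rightarrow> 'a) \<Rightarrow> bool" where
  "kato_type B \<longleftrightarrow> (\<exists>M N. is_GKD B M N \<and> (\<exists>d. \<forall>x\<in>N. (B ^^ d) x = 0))"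

definition essentially_semi_regular :: "('a::right_quat_hilbert \<Rightarrow> 'a) \<Rightarrow> bool" where
  "essentially_semi_regular B \<longleftrightarrow> (\<exists>M N. is_GKD B M N \<and> right_finite_dim N)"


section \<open>S-spectra\<close>

definition R_op :: "quat \<Rightarrow> ('a::right_quat_hilbert \<Rightarrow> 'a) \<Rightarrow> 'a \<Rightarrow> 'a" where
  "R_op q A = (\<lambda>x. A (A x) - (2 * qRe q) *\<^sub>R A x + (norm q)\<^sup>2 *\<^sub>R x)"

definition S_spectrum :: "('a::right_quat_hilbert \<Rightarrow> 'a) \<Rightarrow> quat set" where
  "S_spectrum A =
     {q. \<not> (\<exists>B. bounded_right_linear B \<and> B \<circ> R_op q A = id \<and> R_op q A \<circ> B = id)}"

definition kato_S_spectrum :: "('a::right_quat_hilbert \<Rightarrow> 'a) \<Rightarrow> quat set" where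
  "kato_S_spectrum A = {q. \<not> semi_regular (R_op q A)}"

definition gen_kato_S_spectrum :: "('a::right_quat_hilbert \<Rightarrow> 'a) \<Rightarrow> quat set" where
  "gen_kato_S_spectrum A = {q. \<not> kato_type (R_op q A)}"

definition ess_semi_regular_S_spectrum :: "('a::right_quat_hilbert \<Rightarrow> 'a) \<Rightarrow> quat set" where
  "ess_semi_regular_S_spectrum A = {q. \<not> essentially_semi_regular (R_op q A)}"

text \<open>\<open>R_op q A\<close> depends on \<open>q\<close> only through the similarity class of \<open>q\<close>, so each of these spectra
  is a union of classes, and the ``points'' of a spectrum can only be counted, or be isolated, as
  classes: the class of a non-real \<open>q\<close> is an uncountable set without isolated points. The following
  is \<^const>\<open>isolated_in\<close> with \<open>{q}\<close> replaced by the class of \<open>q\<close>; for real \<open>q\<close> the two coincide.\<close>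

definition sphere_isolated_in :: "quat \<Rightarrow> quat set \<Rightarrow> bool" where
  "sphere_isolated_in q X \<longleftrightarrow> q \<in> X \<and> (\<exists>U. open U \<and> U \<inter> X = qsphere q)"

end

theory Submission
  imports Defs
begin

text \<open>
  Everything follows from one statement (\<open>kato_type_imp_punctured_semi_regular\<close>): if \<open>R_op q A\<close> is
  of Kato type, then \<open>R_op p A\<close> is semi-regular for every \<open>p\<close> in a neighbourhood of the sphere
  \<open>[q]\<close> that does not lie on the sphere itself. On the sphere the operators coincide, and semi-regular
  operators are both of Kato type and essentially semi-regular. An essentially semi-regular operator
  is of Kato type, because a quasi-nilpotent operator on a finite dimensional space is nilpotent.
  Hence the complements of the two spectra are open, and a sphere of the Kato or of the essentially
  semi-regular S-spectrum that misses the generalized Kato S-spectrum is isolated; a second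
  countable space has room for only countably many isolated spheres. Boundedness and the inclusion
  in the S-spectrum hold because operators that are bounded below are semi-regular.

  For the punctured neighbourhood, put \<open>T = R_op q A\<close> and \<open>T' = R_op p A\<close>. The summands of a Kato
  decomposition of \<open>T\<close> need not be invariant under \<open>A\<close>, hence not under \<open>T'\<close>. But if \<open>T\<close> is
  nilpotent of order \<open>d\<close> on the second summand, then \<open>W = range (T ^^ d)\<close> is closed, \<open>T\<close> is
  semi-regular on \<open>W\<close>, and \<open>W\<close> is invariant under everything that commutes with \<open>T\<close>. On \<open>W\<close> the
  operator \<open>T'\<close> is a small commuting perturbation of \<open>T\<close>, and semi-regularity survives such
  perturbations (\<open>small_commuting_perturbation\<close>): on the largest subspace that \<open>T\<close> maps
  onto itself, the intersection of the images of the powers, \<open>T\<close> is an open map, and modulo this subspace \<open>T\<close> is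
  bounded below; both properties are stable.

  It remains to pass from \<open>W\<close> back to the whole space. For \<open>p\<close> off the sphere of \<open>q\<close> the two real
  quadratic polynomials defining \<open>T\<close> and \<open>T'\<close> have no common complex root, so
  \<open>\<alpha> T' + \<beta> T = id\<close> with \<open>\<alpha>\<close> and \<open>\<beta>\<close> polynomials in \<open>A\<close> (\<open>quadratic_bezout\<close>). This puts the kernel of
  \<open>T'\<close> into \<open>W\<close>, and shows that \<open>y\<close> is in the range of \<open>T'\<close> as soon as \<open>(T ^^ d) y\<close> is.
\<close>

section \<open>Lifting bounds and closed ranges\<close>

text \<open>The usual geometric series argument: solve approximately, then solve for the residual, and so on.
  It is stated for an arbitrary set \<open>Y\<close> of right-hand sides, with no completeness of the target, so that one
  argument serves the open mapping theorem (\<open>Y\<close> the range), its converse (\<open>Y\<close> the closure of the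
  range) and the stability of surjectivity under perturbation (\<open>Y\<close> a subspace that the
  unperturbed operator maps onto itself).\<close>

lemma successive_approximation:
  fixes F :: "'a::banach \<Rightarrow> 'b::real_normed_vector"
  assumes F: "bounded_linear F" and W: "subspace W" "closed W"
    and r: "0 \<le> r" "r < 1" and C: "0 \<le> C"
    and step: "\<And>y. y \<in> Y \<Longrightarrow> \<exists>x\<in>W. norm x \<le> C * norm y \<and> y - F x \<in> Y \<and> norm (y - F x) \<le> r * norm y"
    and y: "y \<in> Y"
  shows "\<exists>x\<in>W. F x = y \<and> norm x \<le> C / (1 - r) * norm y"
proof -
  interpret F: bounded_linear F by (rule F)
  obtain g where g: "\<And>y. y \<in> Y \<Longrightarrow> g y \<in> W \<and> norm (g y) \<le> C * norm y \<and> y - F (g y) \<in> Y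
      \<and> norm (y - F (g y)) \<le> r * norm y"
    using step by metis
  define res where "res n = ((\<lambda>y. y - F (g y)) ^^ n) y" for n
  define x where "x n = g (res n)" for n
  have res0: "res 0 = y" and resS: "res (Suc n) = res n - F (x n)" for n
    by (simp_all add: res_def x_def)
  have resY: "res n \<in> Y" for n
    by (induction n) (use y g in \<open>auto simp: res0 resS x_def\<close>)
  have res_le: "norm (res n) \<le> r ^ n * norm y" for n
  proof (induction n)
    case (Suc n)
    have "norm (res (Suc n)) \<le> r * norm (res n)" using g[OF resY] by (simp add: resS x_def)
    also have "\<dots> \<le> r * (r ^ n * norm y)" using Suc r by (intro mult_left_mono) auto
    finally show ?case by simp
  qed (simp add: res0)
  have xW: "x n \<in> W" for n using g[OF resY] by (simp add: x_def)
  have x_le: "norm (x n) \<le> C * norm y * r ^ n" for n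
  proof -
    have "norm (x n) \<le> C * norm (res n)" using g[OF resY] by (simp add: x_def)
    also have "\<dots> \<le> C * (r ^ n * norm y)" using res_le C by (intro mult_left_mono) auto
    finally show ?thesis by (simp add: mult_ac)
  qed
  have geo: "(\<lambda>n. C * norm y * r ^ n) sums (C * norm y * (1 / (1 - r)))"
    using r by (intro sums_mult geometric_sums) auto
  have sumn: "summable (\<lambda>n. norm (x n))"
    by (rule summable_comparison_test'[OF sums_summable[OF geo], of 0]) (use x_le in auto)
  have lim: "(\<lambda>n. \<Sum>i<n. x i) \<longlonglongrightarrow> suminf x"
    by (rule summable_LIMSEQ[OF summable_norm_cancel[OF sumn]])
  have "suminf x \<in> W"
    by (rule closed_sequentially[OF W(2) _ lim]) (use xW W in \<open>auto intro: subspace_sum\<close>)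
  moreover have "norm (suminf x) \<le> C / (1 - r) * norm y"
  proof -
    have "norm (suminf x) \<le> (\<Sum>n. norm (x n))" by (rule summable_norm[OF sumn])
    also have "\<dots> \<le> (\<Sum>n. C * norm y * r ^ n)"
      by (rule suminf_le[OF x_le sumn sums_summable[OF geo]])
    finally show ?thesis using sums_unique[OF geo] by simp
  qed
  moreover have "F (suminf x) = y"
  proof -
    have F_sum: "F (\<Sum>i<n. x i) = y - res n" for n
      by (induction n) (simp_all add: res0 resS F.add)
    have "(\<lambda>n. r ^ n * norm y) \<longlonglongrightarrow> 0"
      using r by (intro tendsto_mult_left_zero LIMSEQ_power_zero) auto
    then have "res \<longlonglongrightarrow> 0"
      by (rule Lim_null_comparison[rotated]) (use res_le in auto)
    then have "(\<lambda>n. F (\<Sum>i<n. x i)) \<longlonglongrightarrow> y - 0"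
      unfolding F_sum by (intro tendsto_intros)
    moreover have "(\<lambda>n. F (\<Sum>i<n. x i)) \<longlonglongrightarrow> F (suminf x)" by (intro F.tendsto lim)
    ultimately show ?thesis using LIMSEQ_unique by fastforce
  qed
  ultimately show ?thesis by blast
qed

lemma subspace_closure:
  fixes S :: "'a::real_normed_vector set"
  assumes "subspace S"
  shows "subspace (closure S)"
proof (rule subspaceI)
  show "0 \<in> closure S" using closure_subset subspace_0[OF assms] by blast
next
  fix x y :: 'a
  assume "x \<in> closure S" "y \<in> closure S"
  then obtain f g where "\<forall>n. f n \<in> S" "f \<longlonglongrightarrow> x" "\<forall>n. g n \<in> S" "g \<longlonglongrightarrow> y"
    unfolding closure_sequential by auto
  then show "x + y \<in> closure S"
    unfolding closure_sequential using assms
    by (intro exI[of _ "\<lambda>n. f n + g n"]) (auto intro!: tendsto_add subspace_add)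
next
  fix c :: real and x :: 'a
  assume "x \<in> closure S"
  then obtain f where "\<forall>n. f n \<in> S" "f \<longlonglongrightarrow> x" unfolding closure_sequential by auto
  then show "c *\<^sub>R x \<in> closure S"
    unfolding closure_sequential using assms
    by (intro exI[of _ "\<lambda>n. c *\<^sub>R f n"]) (auto intro!: tendsto_scaleR subspace_scale)
qed

text \<open>A quantitative form of openness onto the range: every value is attained at a point of
  controlled norm. It replaces the quotient by the kernel; for an injective map it says that the
  map is bounded below.\<close>

definition lifting_bound ::
    "real \<Rightarrow> ('a::real_normed_vector \<Rightarrow> 'b::real_normed_vector) \<Rightarrow> 'a set \<Rightarrow> bool" where
  "lifting_bound C F W \<longleftrightarrow> C > 0 \<and> (\<forall>x\<in>W. \<exists>w\<in>W. F w = F x \<and> norm w \<le> C * norm (F x))"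

lemma lifting_boundD:
  "lifting_bound C F W \<Longrightarrow> y \<in> F ` W \<Longrightarrow> \<exists>w\<in>W. F w = y \<and> norm w \<le> C * norm y"
  by (auto simp: lifting_bound_def)

lemma lifting_bound_imp_closed:
  fixes F :: "'a::banach \<Rightarrow> 'b::real_normed_vector"
  assumes F: "bounded_linear F" and W: "subspace W" "closed W" and C: "lifting_bound C F W"
  shows "closed (F ` W)"
proof -
  interpret F: bounded_linear F by (rule F)
  have C0: "C > 0" using C by (simp add: lifting_bound_def)
  have sFW: "subspace (F ` W)" by (rule linear_subspace_image[OF F.linear W(1)])
  have scl: "subspace (closure (F ` W))" by (rule subspace_closure[OF sFW])
  have step: "\<exists>x\<in>W. norm x \<le> 2 * C * norm y \<and> y - F x \<in> closure (F ` W)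
      \<and> norm (y - F x) \<le> 1 / 2 * norm y" if y: "y \<in> closure (F ` W)" for y
  proof (cases "y = 0")
    case True
    then show ?thesis using W sFW by (intro bexI[of _ 0]) (auto simp: subspace_0 F.zero scl)
  next
    case False
    then have "norm y / 2 > 0" by simp
    then obtain z where z: "z \<in> F ` W" "dist z y < norm y / 2"
      using y unfolding closure_approachable by blast
    then obtain w where w: "w \<in> W" "F w = z" "norm w \<le> C * norm z"
      using lifting_boundD[OF C] by blast
    have "norm z \<le> 2 * norm y"
      using z(2) norm_triangle_sub[of z y] norm_ge_zero[of y] unfolding dist_norm by linarith
    then have "norm w \<le> C * (2 * norm y)"
      using w(3) C0 mult_left_mono[of "norm z" "2 * norm y" C] by linarith
    moreover have "y - F w \<in> closure (F ` W)"
      using subspace_diff[OF scl y] w z closure_subset[of "F ` W"] by blast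
    ultimately show ?thesis using w z by (intro bexI[of _ w]) (auto simp: dist_norm norm_minus_commute)
  qed
  have "y \<in> F ` W" if "y \<in> closure (F ` W)" for y
    using successive_approximation[OF F W, of "1/2" "2 * C" "closure (F ` W)" y] step that C0 by auto
  then have "closure (F ` W) \<subseteq> F ` W" by blast
  then show ?thesis using closure_subset_eq by blast
qed

text \<open>The open mapping theorem for \<open>F\<close> as a map from \<open>W\<close> onto its image, which is complete because it is closed:
  by Baire, the closure of the image of some ball has interior in \<open>F ` W\<close>; differences of points of that image
  approximate all small vectors of \<open>F ` W\<close>.\<close>

lemma closed_image_imp_lifting_bound:
  fixes F :: "'a::banach \<Rightarrow> 'b::banach"
  assumes F: "bounded_linear F" and W: "subspace W" "closed W" and FW: "closed (F ` W)"
  shows "\<exists>C. lifting_bound C F W"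
proof -
  interpret F: bounded_linear F by (rule F)
  define Y where "Y = F ` W"
  define K where "K n = closure (F ` (W \<inter> cball 0 (real n)))" for n
  have sY: "subspace Y" unfolding Y_def by (rule linear_subspace_image[OF F.linear W(1)])
  have KY: "K n \<subseteq> Y" for n
    unfolding K_def Y_def by (rule closure_minimal[OF _ FW]) auto
  have cover: "Y \<subseteq> (\<Union>n. K n)"
  proof
    fix y assume "y \<in> Y"
    then obtain x where x: "x \<in> W" "y = F x" by (auto simp: Y_def)
    obtain n where "norm x \<le> real n" using real_arch_simple by blast
    then show "y \<in> (\<Union>n. K n)" unfolding K_def using x closure_subset by fastforce
  qed
  have "\<exists>n. (top_of_set Y) interior_of (K n) \<noteq> {}"
  proof (rule ccontr)
    assume *: "\<not> ?thesis"
    have "(top_of_set Y) interior_of \<Union>(range K) = {}"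
    proof (rule Baire_category_alt)
      show "completely_metrizable_space (top_of_set Y) \<or>
          locally_compact_space (top_of_set Y) \<and> regular_space (top_of_set Y)"
        using completely_metrizable_space_closedin[OF completely_metrizable_space_euclidean, of Y] FW
        by (auto simp: Y_def)
      show "closedin (top_of_set Y) T \<and> (top_of_set Y) interior_of T = {}" if "T \<in> range K" for T
        using that * KY by (auto simp: K_def intro!: closed_subset)
    qed auto
    moreover have "\<Union>(range K) = Y" using cover KY by auto
    moreover have "(top_of_set Y) interior_of Y = Y" using interior_of_topspace[of "top_of_set Y"] by simp
    ultimately show False using subspace_0[OF sY] by auto
  qed
  then obtain n y0 where "y0 \<in> (top_of_set Y) interior_of (K n)" by blast
  then obtain U where U: "openin (top_of_set Y) U" "y0 \<in> U" "U \<subseteq> K n"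
    by (auto simp: interior_of_def)
  then have y0: "y0 \<in> Y" using KY by blast
  obtain e where e: "e > 0" "ball y0 e \<inter> Y \<subseteq> K n"
    using U unfolding openin_contains_ball by (meson order_trans)
  have small: "\<exists>x\<in>W. norm x \<le> 2 * real n \<and> norm (y - F x) \<le> d"
    if y: "y \<in> Y" "norm y < e" and d: "d > 0" for y d
  proof -
    have approx: "\<exists>a\<in>W. norm a \<le> real n \<and> dist (F a) z < d / 2" if "z \<in> K n" for z
    proof -
      have "\<exists>v\<in>F ` (W \<inter> cball 0 (real n)). dist v z < d / 2"
        using that half_gt_zero[OF d] unfolding K_def closure_approachable by blast
      then show ?thesis by auto
    qed
    have "y0 + y \<in> ball y0 e \<inter> Y"
      using y y0 sY by (simp add: subspace_add dist_norm)
    then have "y0 + y \<in> K n" using e(2) by blast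
    then obtain a where a: "a \<in> W" "norm a \<le> real n" "dist (F a) (y0 + y) < d / 2"
      using approx by blast
    have "y0 \<in> K n" using y0 e by auto
    then obtain b where b: "b \<in> W" "norm b \<le> real n" "dist (F b) y0 < d / 2"
      using approx by blast
    have "norm (y - F (a - b)) = norm ((y0 + y - F a) - (y0 - F b))"
      by (simp add: F.diff algebra_simps)
    also have "\<dots> \<le> norm (y0 + y - F a) + norm (y0 - F b)" by (rule norm_triangle_ineq4)
    also have "\<dots> \<le> d" using a(3) b(3) by (simp add: dist_norm norm_minus_commute)
    finally have "norm (y - F (a - b)) \<le> d" .
    moreover have "norm (a - b) \<le> 2 * real n" using norm_triangle_ineq4[of a b] a b by linarith
    ultimately show ?thesis using a b W(1) by (intro bexI[of _ "a - b"]) (auto intro: subspace_diff)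
  qed
  define C where "C = 2 * (2 * real n + 1) / e"
  have C0: "C > 0" using e by (simp add: C_def)
  have step: "\<exists>x\<in>W. norm x \<le> C * norm y \<and> y - F x \<in> Y \<and> norm (y - F x) \<le> 1 / 2 * norm y"
    if y: "y \<in> Y" for y
  proof (cases "y = 0")
    case True
    then show ?thesis using W sY by (intro bexI[of _ 0]) (auto simp: subspace_0 F.zero)
  next
    case False
    define s where "s = e / (2 * norm y)"
    have s: "s > 0" using False e by (simp add: s_def)
    have "norm (s *\<^sub>R y) < e" using False e by (simp add: s_def)
    then obtain x where x: "x \<in> W" "norm x \<le> 2 * real n" "norm (s *\<^sub>R y - F x) \<le> s * norm y / 2"
      using small[of "s *\<^sub>R y" "s * norm y / 2"] y False s sY by (auto simp: subspace_scale)
    define w where "w = (1 / s) *\<^sub>R x"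
    have wW: "w \<in> W" using x W by (simp add: w_def subspace_scale)
    have "norm w = norm x / s" using s by (simp add: w_def)
    also have "\<dots> \<le> (2 * real n + 1) / s" using x(2) s by (intro divide_right_mono) auto
    also have "\<dots> = C * norm y" using False e by (simp add: C_def s_def field_simps)
    finally have 1: "norm w \<le> C * norm y" .
    have "y - F w = (1 / s) *\<^sub>R (s *\<^sub>R y - F x)" using s by (simp add: w_def F.scaleR algebra_simps)
    then have "norm (y - F w) = norm (s *\<^sub>R y - F x) / s" using s by simp
    also have "\<dots> \<le> (s * norm y / 2) / s" using x(3) s by (intro divide_right_mono) auto
    finally have 2: "norm (y - F w) \<le> 1 / 2 * norm y" using s by simp
    have "y - F w \<in> Y" using y wW sY by (intro subspace_diff) (auto simp: Y_def)
    with 1 2 wW show ?thesis by blast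
  qed
  have "\<exists>w\<in>W. F w = y \<and> norm w \<le> C / (1 - 1/2) * norm y" if "y \<in> Y" for y
    by (rule successive_approximation[OF F W, of "1/2" C Y y]) (use step that C0 in auto)
  then have "lifting_bound (C / (1 - 1/2)) F W"
    using C0 by (auto simp: lifting_bound_def Y_def)
  then show ?thesis by blast
qed


section \<open>Semi-regular operators\<close>

lemma bounded_linear_funpow:
  fixes T :: "'a::real_normed_vector \<Rightarrow> 'a"
  assumes "bounded_linear T"
  shows "bounded_linear (T ^^ n)"
proof (induction n)
  case (Suc n)
  then show ?case using bounded_linear_compose[OF assms Suc] by (simp add: o_def)
qed (simp add: id_def)

lemma funpow_image_subset: "T ` W \<subseteq> W \<Longrightarrow> (T ^^ n) ` W \<subseteq> W"
  by (induction n) auto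

lemma funpow_commute_on:
  assumes "T ` W \<subseteq> W" "\<And>x. x \<in> W \<Longrightarrow> S (T x) = T (S x)" "x \<in> W"
  shows "S ((T ^^ n) x) = (T ^^ n) (S x)"
proof (induction n)
  case (Suc n)
  have "(T ^^ n) x \<in> W" using funpow_image_subset[OF assms(1)] assms(3) by blast
  then show ?case using Suc assms(2) by simp
qed simp

text \<open>A preimage in \<open>W\<close> of a point of \<open>F ` L\<close> differs from a preimage in \<open>L\<close> by an element of the
  kernel, so it lies in \<open>L\<close> already.\<close>

lemma lifting_bound_kernel_superset:
  assumes F: "linear F" and C: "lifting_bound C F W"
    and L: "subspace L" "L \<subseteq> W" "{x \<in> W. F x = 0} \<subseteq> L" and W: "subspace W"
  shows "lifting_bound C F L"
proof -
  have "\<exists>w\<in>L. F w = F x \<and> norm w \<le> C * norm (F x)" if x: "x \<in> L" for x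
  proof -
    obtain w where w: "w \<in> W" "F w = F x" "norm w \<le> C * norm (F x)"
      using C x L(2) unfolding lifting_bound_def by blast
    have "w - x \<in> W" using w x L W by (auto intro: subspace_diff)
    moreover have "F (w - x) = 0" using w by (simp add: linear_diff[OF F])
    ultimately have "w - x \<in> L" using L(3) by blast
    from subspace_add[OF L(1) this x] have "w \<in> L" by simp
    then show ?thesis using w by blast
  qed
  then show ?thesis using C by (auto simp: lifting_bound_def)
qed

lemma closed_image_kernel_superset:
  fixes F :: "'a::banach \<Rightarrow> 'b::banach"
  assumes F: "bounded_linear F" and W: "subspace W" "closed W" "closed (F ` W)"
    and L: "subspace L" "closed L" "L \<subseteq> W" "{x \<in> W. F x = 0} \<subseteq> L"
  shows "closed (F ` L)"
proof -
  obtain C where "lifting_bound C F W" using closed_image_imp_lifting_bound[OF F W] by blast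
  then have "lifting_bound C F L"
    using lifting_bound_kernel_superset bounded_linear.linear[OF F] L W by blast
  then show ?thesis using lifting_bound_imp_closed F L by blast
qed

locale semi_regular_restriction =
  fixes T :: "'a::banach \<Rightarrow> 'a" and W :: "'a set"
  assumes T: "bounded_linear T" and W: "subspace W" "closed W" "T ` W \<subseteq> W"
    and closed_range: "closed (T ` W)" and kernel: "{x \<in> W. T x = 0} \<subseteq> (\<Inter>n. (T ^^ n) ` W)"
begin

interpretation T: bounded_linear T by (rule T)

lemma powers_subspace: "subspace ((T ^^ n) ` W)"
  by (rule linear_subspace_image[OF bounded_linear.linear[OF bounded_linear_funpow[OF T]] W(1)])

text \<open>Each power image contains the kernel of \<open>T\<close> on \<open>W\<close>, so \<open>T\<close> maps it to a closed set again.\<close>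

lemma powers_closed: "closed ((T ^^ n) ` W)"
proof (induction n)
  case (Suc n)
  have "closed (T ` ((T ^^ n) ` W))"
    using closed_image_kernel_superset[OF T W(1,2) closed_range powers_subspace Suc]
      funpow_image_subset[OF W(3)] kernel by blast
  then show ?case by (simp add: image_comp)
qed (use W in simp)

text \<open>Also called the hyper-range of the restriction of \<open>T\<close> to \<open>W\<close>.\<close>

definition core :: "'a set" where "core = (\<Inter>n. (T ^^ n) ` W)"

lemma core_subspace: "subspace core"
  unfolding core_def using powers_subspace subspace_Inter[of "range (\<lambda>n. (T ^^ n) ` W)"] by blast

lemma core_closed: "closed core"
  unfolding core_def using powers_closed by blast

lemma core_subset: "core \<subseteq> W"
proof
  show "x \<in> W" if "x \<in> core" for x
    using INT_D[OF that[unfolded core_def], of 0] by simp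
qed

lemma core_kernel: "{x \<in> W. T x = 0} \<subseteq> core"
  using kernel by (simp add: core_def)

text \<open>Surjectivity on the core: a preimage of \<open>(T ^^ Suc n) w\<close> differs from \<open>(T ^^ n) w\<close> by an element of the
  kernel, and the kernel is contained in all images of powers.\<close>

lemma core_image: "T ` core = core"
proof
  have "T x \<in> (T ^^ n) ` W" if x: "x \<in> core" for x n
  proof -
    obtain w where "w \<in> W" "x = (T ^^ n) w" using x by (auto simp: core_def)
    then have "T x = (T ^^ n) (T w)" "T w \<in> W" using W(3) by (auto simp: funpow_swap1)
    then show ?thesis by blast
  qed
  then show "T ` core \<subseteq> core" by (auto simp: core_def)
  show "core \<subseteq> T ` core"
  proof
    fix y assume y: "y \<in> core"
    then have "y \<in> (T ^^ 1) ` W" unfolding core_def by blast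
    then obtain x where x: "x \<in> W" "y = T x" by auto
    have "x \<in> (T ^^ n) ` W" for n
    proof -
      have "y \<in> (T ^^ Suc n) ` W" using y unfolding core_def by blast
      then obtain w where w: "w \<in> W" "y = T ((T ^^ n) w)" by auto
      have pw: "(T ^^ n) w \<in> W" using w funpow_image_subset[OF W(3)] by blast
      have "x - (T ^^ n) w \<in> {x \<in> W. T x = 0}"
        using x w pw W(1) by (simp add: T.diff subspace_diff)
      then have "x - (T ^^ n) w \<in> (T ^^ n) ` W" using kernel by blast
      from subspace_add[OF powers_subspace this, of "(T ^^ n) w"] w show ?thesis by simp
    qed
    then show "y \<in> T ` core" using x by (auto simp: core_def)
  qed
qed

text \<open>Let \<open>F = T + S\<close>. On the core, which \<open>S\<close> preserves because it commutes with \<open>T\<close>, \<open>F\<close> is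
  onto with a lifting bound, like \<open>T\<close>. Modulo the core, \<open>T\<close> is bounded below with constant \<open>1 / C\<close>, hence
  \<open>F\<close> with constant \<open>1 / (2 * C)\<close>. So the kernel of \<open>F\<close> lies in the core, which \<open>F\<close> maps onto itself, and
  combining the two estimates bounds preimages under \<open>F\<close>.\<close>

lemma small_commuting_perturbation:
  assumes C: "lifting_bound C T W"
    and S: "bounded_linear S" "S ` W \<subseteq> W" "\<And>x. x \<in> W \<Longrightarrow> S (T x) = T (S x)"
    and s: "\<And>x. norm (S x) \<le> s * norm x" "0 \<le> s" "C * s \<le> 1 / 2"
  shows "closed ((\<lambda>x. T x + S x) ` W)"
    and "{x \<in> W. T x + S x = 0} \<subseteq> (\<Inter>n. ((\<lambda>x. T x + S x) ^^ n) ` W)"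
proof -
  interpret S: bounded_linear S by (rule S)
  define F where "F = (\<lambda>x. T x + S x)"
  have F: "bounded_linear F" unfolding F_def by (rule bounded_linear_add[OF T S(1)])
  interpret F: bounded_linear F by (rule F)
  have C0: "C > 0" using C by (simp add: lifting_bound_def)
  have Score: "S x \<in> core" if x: "x \<in> core" for x
  proof -
    have "S x \<in> (T ^^ n) ` W" for n
    proof -
      obtain w where w: "w \<in> W" "x = (T ^^ n) w" using x by (auto simp: core_def)
      then have "S x = (T ^^ n) (S w)"
        using funpow_commute_on[where S = S and T = T and W = W, OF W(3)] S(3) by simp
      then show ?thesis using w S(2) by blast
    qed
    then show ?thesis by (auto simp: core_def)
  qed
  have Fcore: "F x \<in> core" if "x \<in> core" for x
    unfolding F_def using that Score core_image by (intro subspace_add[OF core_subspace]) auto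
  have core_lift: "lifting_bound C T core"
    using lifting_bound_kernel_superset[OF T.linear C core_subspace core_subset core_kernel W(1)] .
  define K where "K = C / (1 - C * s)"
  have onto: "\<exists>x\<in>core. F x = y \<and> norm x \<le> K * norm y" if y: "y \<in> core" for y
    unfolding K_def
  proof (rule successive_approximation[OF F core_subspace core_closed, where Y = core])
    fix y assume y: "y \<in> core"
    then have "y \<in> T ` core" by (simp add: core_image)
    then obtain w where w: "w \<in> core" "T w = y" "norm w \<le> C * norm y"
      using lifting_boundD[OF core_lift] by blast
    have eq: "y - F w = - S w" using w by (simp add: F_def)
    have "norm (S w) \<le> s * (C * norm y)"
      using s(1)[of w] mult_left_mono[OF w(3) s(2)] by linarith
    then show "\<exists>x\<in>core. norm x \<le> C * norm y \<and> y - F x \<in> core \<and> norm (y - F x) \<le> C * s * norm y"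
      using w Score core_subspace by (intro bexI[of _ w]) (auto simp: eq subspace_neg mult_ac)
  qed (use y C0 s in auto)
  have core_range: "core \<subseteq> (F ^^ n) ` core" for n
  proof (induction n)
    case (Suc n)
    have "core \<subseteq> F ` core" using onto by blast
    also have "\<dots> \<subseteq> F ` ((F ^^ n) ` core)" using Suc by (rule image_mono)
    finally show ?case by (simp add: image_comp)
  qed simp
  \<comment> \<open>The norm of the class of \<open>x\<close> in the quotient by the core is \<open>infdist x core\<close>.\<close>
  have below: "infdist x core \<le> 2 * C * norm (F x)" if x: "x \<in> W" for x
  proof -
    have ne: "core \<noteq> {}" using subspace_0[OF core_subspace] by blast
    have "2 * (infdist x core - C * norm (F x)) \<le> dist x m" if m: "m \<in> core" for m
    proof -
      have "F m \<in> T ` core" using Fcore[OF m] by (simp add: core_image)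
      then obtain m' where m': "m' \<in> core" "T m' = F m" by (metis imageE)
      have z: "x - m + m' \<in> W"
        using x m m' core_subset W(1) by (auto intro!: subspace_add subspace_diff)
      then obtain w where w: "w \<in> W" "T w = T (x - m + m')" "norm w \<le> C * norm (T (x - m + m'))"
        using C unfolding lifting_bound_def by blast
      have "x - m + m' - w \<in> core"
        using z w W(1) by (intro subsetD[OF core_kernel]) (simp add: T.diff subspace_diff)
      from subspace_add[OF core_subspace this subspace_diff[OF core_subspace m m'(1)]]
      have "(x - m + m' - w) + (m - m') \<in> core" .
      then have "x - w \<in> core" by (simp add: algebra_simps)
      then have "infdist x core \<le> norm w" using infdist_le[of "x - w" core x] by (simp add: dist_norm)
      also have "\<dots> \<le> C * norm (T (x - m + m'))" by (rule w)
      also have "T (x - m + m') = F x - S (x - m)"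
        using m'(2) by (simp add: F_def T.add T.diff S.diff)
      also have "C * norm (F x - S (x - m)) \<le> C * (norm (F x) + s * norm (x - m))"
        using norm_triangle_ineq4[of "F x" "S (x - m)"] s(1)[of "x - m"] C0
        by (intro mult_left_mono) auto
      also have "\<dots> \<le> C * norm (F x) + 1 / 2 * norm (x - m)"
        using mult_right_mono[OF s(3), of "norm (x - m)"] by (simp add: algebra_simps)
      finally show ?thesis by (simp add: dist_norm)
    qed
    then have "2 * (infdist x core - C * norm (F x)) \<le> infdist x core"
      unfolding infdist_notempty[OF ne] by (intro cINF_greatest[OF ne]) auto
    then show ?thesis by simp
  qed
  have kerF: "{x \<in> W. F x = 0} \<subseteq> core"
  proof safe
    fix x assume x: "x \<in> W" "F x = 0"
    then have "infdist x core = 0" using below[of x] infdist_nonneg[of x core] by simp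
    then show "x \<in> core"
      using in_closed_iff_infdist_zero[OF core_closed] subspace_0[OF core_subspace] by blast
  qed
  have "core \<subseteq> (F ^^ n) ` W" for n
    using core_range core_subset by (meson image_mono order_trans)
  then have ker: "{x \<in> W. F x = 0} \<subseteq> (\<Inter>n. (F ^^ n) ` W)" using kerF by blast
  obtain B where B: "B > 0" "\<And>x. norm (F x) \<le> norm x * B" using F.pos_bounded by blast
  \<comment> \<open>Given \<open>F x\<close>, correct \<open>x\<close> by a nearly closest core element \<open>l\<close> and restore the value by a bounded
     lift of \<open>F l\<close> in the core; the factor 3 instead of 2 makes room for an infimum that is not attained.\<close>
  define D where "D = 3 * C + K * (1 + B * (3 * C))"
  have K0: "K > 0" using C0 s by (simp add: K_def)
  have "\<exists>w\<in>W. F w = F x \<and> norm w \<le> D * norm (F x)" if x: "x \<in> W" for x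
  proof (cases "F x = 0")
    case True
    then show ?thesis using W(1) by (intro bexI[of _ 0]) (auto simp: F.zero subspace_0)
  next
    case False
    have ne: "core \<noteq> {}" using subspace_0[OF core_subspace] by blast
    have "infdist x core < 3 * C * norm (F x)" using below[OF x] False C0 mult_pos_pos[of C "norm (F x)"]
      by (simp add: order.strict_trans1)
    then have "\<exists>l\<in>core. dist x l < 3 * C * norm (F x)"
      unfolding infdist_notempty[OF ne] by (subst (asm) cINF_less_iff[OF ne]) (auto intro!: bdd_belowI[of _ 0])
    then obtain l where l: "l \<in> core" "norm (x - l) \<le> 3 * C * norm (F x)" by (auto simp: dist_norm)
    obtain l' where l': "l' \<in> core" "F l' = F l" "norm l' \<le> K * norm (F l)"
      using onto[OF Fcore[OF l(1)]] by blast
    have "norm (F l) \<le> norm (F x) + norm (F (x - l))"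
      using norm_triangle_ineq4[of "F x" "F (x - l)"] by (simp add: F.diff)
    also have "norm (F (x - l)) \<le> norm (x - l) * B" by (rule B)
    also have "\<dots> \<le> 3 * C * norm (F x) * B" using l(2) B(1) by (intro mult_right_mono) auto
    finally have "norm (F l) \<le> (1 + B * (3 * C)) * norm (F x)" by (simp add: algebra_simps)
    then have "K * norm (F l) \<le> K * ((1 + B * (3 * C)) * norm (F x))" using K0 by simp
    then have "norm (x - l + l') \<le> D * norm (F x)"
      using norm_triangle_ineq[of "x - l" l'] l l' by (simp add: D_def algebra_simps)
    moreover have "F (x - l + l') = F x" using l' by (simp add: F.add F.diff)
    moreover have "x - l + l' \<in> W"
      using x l l' core_subset W(1) by (auto intro!: subspace_add subspace_diff)
    ultimately show ?thesis by blast
  qed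
  moreover have "D > 0" using C0 K0 B(1) by (simp add: D_def add_pos_pos)
  ultimately have "lifting_bound D F W" by (simp add: lifting_bound_def)
  then have "closed (F ` W)" by (rule lifting_bound_imp_closed[OF F W(1,2)])
  then show "closed ((\<lambda>x. T x + S x) ` W)" by (simp add: F_def)
  show "{x \<in> W. T x + S x = 0} \<subseteq> (\<Inter>n. ((\<lambda>x. T x + S x) ^^ n) ` W)"
    using ker by (simp add: F_def)
qed

end


section \<open>Removing the nilpotent summand\<close>

text \<open>Here \<open>a\<^sup>2 \<le> m\<close> and \<open>b\<^sup>2 \<le> n\<close> say that both quadratics have a pair of conjugate complex
  roots (a double root in the case of equality), so different quadratics have no root in common.\<close>

lemma quadratic_bezout:
  fixes A :: "'a::real_vector \<Rightarrow> 'a" and a b m n :: real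
  assumes A: "linear A" and real_bound: "a\<^sup>2 \<le> m" "b\<^sup>2 \<le> n" and ne: "(a, m) \<noteq> (b, n)"
  defines "P \<equiv> \<lambda>x. A (A x) - (2 * a) *\<^sub>R A x + m *\<^sub>R x"
    and "Q \<equiv> \<lambda>x. A (A x) - (2 * b) *\<^sub>R A x + n *\<^sub>R x"
  shows "\<exists>c0 c1 d0 d1. \<forall>x. (d0 *\<^sub>R Q x + d1 *\<^sub>R A (Q x)) + (c0 *\<^sub>R P x + c1 *\<^sub>R A (P x)) = x"
proof -
  \<comment> \<open>\<open>Q - P\<close> is the linear polynomial \<open>2 * e * X + f\<close>; dividing \<open>4 * e\<^sup>2 * P\<close> by it leaves the
     remainder \<open>r\<close>, which is the resultant of \<open>P\<close> and \<open>Q\<close>. For \<open>e = 0\<close> it is \<open>f\<^sup>2\<close>.\<close>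
  define e f r where "e = a - b" and "f = n - m" and "r = 4 * e\<^sup>2 * (m - a\<^sup>2) + (f + 2 * e * a)\<^sup>2"
  have "r \<noteq> 0"
  proof
    assume "r = 0"
    moreover have "4 * e\<^sup>2 * (m - a\<^sup>2) \<ge> 0" using real_bound by simp
    ultimately have 1: "4 * e\<^sup>2 * (m - a\<^sup>2) = 0" "f + 2 * e * a = 0"
      using zero_le_power2[of "f + 2 * e * a"] unfolding r_def by (auto simp: add_nonneg_eq_0_iff)
    show False
    proof (cases "e = 0")
      case True
      then show False using 1(2) ne by (simp add: e_def f_def)
    next
      case False
      then have "m = a\<^sup>2" using 1(1) by simp
      then have "n = 2 * a * b - a\<^sup>2"
        using 1(2) by (simp add: e_def f_def power2_eq_square algebra_simps)
      then have "(a - b)\<^sup>2 \<le> 0" using real_bound(2) by (simp add: power2_eq_square algebra_simps)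
      then show False using False by (simp add: e_def)
    qed
  qed
  have id: "(f + 4 * e * a) *\<^sub>R Q x + (- 2 * e) *\<^sub>R A (Q x)
      + ((4 * e\<^sup>2 - f - 4 * e * a) *\<^sub>R P x + (2 * e) *\<^sub>R A (P x)) = r *\<^sub>R x" for x
  proof -
    have "(f + 4 * e * a) *\<^sub>R Q x + (- 2 * e) *\<^sub>R A (Q x)
      + ((4 * e\<^sup>2 - f - 4 * e * a) *\<^sub>R P x + (2 * e) *\<^sub>R A (P x))
      = ((f + 4 * e * a) * n + (4 * e\<^sup>2 - f - 4 * e * a) * m) *\<^sub>R x
        + ((f + 4 * e * a) * (- 2 * b) + (- 2 * e) * n + (4 * e\<^sup>2 - f - 4 * e * a) * (- 2 * a) + 2 * e * m) *\<^sub>R A x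
        + ((f + 4 * e * a) + (- 2 * e) * (- 2 * b) + (4 * e\<^sup>2 - f - 4 * e * a) + 2 * e * (- 2 * a)) *\<^sub>R A (A x)
        + (- 2 * e + 2 * e) *\<^sub>R A (A (A x))"
      unfolding P_def Q_def
      by (simp add: linear_add[OF A] linear_diff[OF A] linear_scale[OF A] scaleR_add_left scaleR_add_right
          scaleR_diff_left scaleR_diff_right)
    also have "(f + 4 * e * a) * n + (4 * e\<^sup>2 - f - 4 * e * a) * m = r"
      unfolding r_def e_def f_def by (simp add: power2_eq_square algebra_simps)
    also have "(f + 4 * e * a) * (- 2 * b) + (- 2 * e) * n + (4 * e\<^sup>2 - f - 4 * e * a) * (- 2 * a) + 2 * e * m = 0"
      unfolding e_def f_def by (simp add: power2_eq_square algebra_simps)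
    also have "(f + 4 * e * a) + (- 2 * e) * (- 2 * b) + (4 * e\<^sup>2 - f - 4 * e * a) + 2 * e * (- 2 * a) = 0"
      unfolding e_def f_def by (simp add: power2_eq_square algebra_simps)
    finally show ?thesis by simp
  qed
  have "((f + 4 * e * a) / r) *\<^sub>R Q x + (- 2 * e / r) *\<^sub>R A (Q x)
      + (((4 * e\<^sup>2 - f - 4 * e * a) / r) *\<^sub>R P x + (2 * e / r) *\<^sub>R A (P x)) = x" for x
  proof -
    have "((f + 4 * e * a) / r) *\<^sub>R Q x + (- 2 * e / r) *\<^sub>R A (Q x)
      + (((4 * e\<^sup>2 - f - 4 * e * a) / r) *\<^sub>R P x + (2 * e / r) *\<^sub>R A (P x))
      = (1 / r) *\<^sub>R ((f + 4 * e * a) *\<^sub>R Q x + (- 2 * e) *\<^sub>R A (Q x)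
      + ((4 * e\<^sup>2 - f - 4 * e * a) *\<^sub>R P x + (2 * e) *\<^sub>R A (P x)))"
      by (simp only: scaleR_add_right scaleR_scaleR times_divide_eq_left mult_1_left)
    then show ?thesis using \<open>r \<noteq> 0\<close> by (simp only: id scaleR_scaleR) simp
  qed
  then show ?thesis by blast
qed

text \<open>On the kernel of \<open>T'\<close> the identity \<open>\<alpha> T' + \<beta> T = id\<close> makes \<open>T\<close> invertible with inverse \<open>\<beta>\<close>,
  so kernel elements are values of \<open>T ^^ d\<close>. Modulo the range of \<open>T'\<close> it makes \<open>T\<close> invertible as well,
  so membership in that range can be tested after applying \<open>T ^^ d\<close>, where the range is closed.\<close>

lemma semi_regular_extends_from_power_range:
  fixes T T' \<alpha> \<beta> :: "'a::banach \<Rightarrow> 'a"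
  assumes T: "bounded_linear T" and T': "bounded_linear T'" and lin: "linear \<alpha>" "linear \<beta>"
    and comm: "\<And>x. T (T' x) = T' (T x)" "\<And>x. \<alpha> (T' x) = T' (\<alpha> x)"
      "\<And>x. \<beta> (T' x) = T' (\<beta> x)" "\<And>x. \<beta> (T x) = T (\<beta> x)"
    and bezout: "\<And>x. \<alpha> (T' x) + \<beta> (T x) = x"
    and W: "closed (T' ` range (T ^^ d))"
      "{x \<in> range (T ^^ d). T' x = 0} \<subseteq> (\<Inter>n. (T' ^^ n) ` range (T ^^ d))"
  shows "closed (range T')" and "{x. T' x = 0} \<subseteq> (\<Inter>n. range (T' ^^ n))"
proof -
  interpret T': bounded_linear T' by (rule T')
  have ker: "\<exists>z. T' z = 0 \<and> x = (T ^^ k) z" if "T' x = 0" for x k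
  proof (induction k)
    case (Suc k)
    then obtain z where z: "T' z = 0" "x = (T ^^ k) z" by blast
    have "z = T (\<beta> z)" using bezout[of z] z(1) by (simp add: linear_0[OF lin(1)] comm)
    then have "x = (T ^^ k) (T (\<beta> z))" using z(2) by simp
    moreover have "T' (\<beta> z) = 0" using z(1) by (simp add: linear_0[OF lin(2)] flip: comm)
    ultimately show ?case by (auto simp: funpow_swap1)
  qed (use that in simp)
  show "{x. T' x = 0} \<subseteq> (\<Inter>n. range (T' ^^ n))"
  proof (intro subsetI INT_I)
    fix x n assume "x \<in> {x. T' x = 0}"
    then have "x \<in> {x \<in> range (T ^^ d). T' x = 0}" using ker[of x d] by auto
    then have "x \<in> (T' ^^ n) ` range (T ^^ d)" using W(2) by blast
    then show "x \<in> range (T' ^^ n)" by blast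
  qed
  have descend: "y \<in> range T'" if "(T ^^ k) y \<in> range T'" for k y
    using that
  proof (induction k arbitrary: y)
    case (Suc k)
    then have "T y \<in> range T'" by (simp add: funpow_swap1)
    then obtain u where "T y = T' u" by blast
    then have "y = T' (\<alpha> y + \<beta> u)" using bezout[of y] by (simp add: comm T'.add)
    then show ?case by blast
  qed simp
  have commd: "(T ^^ d) (T' x) = T' ((T ^^ d) x)" for x
    by (induction d) (simp_all add: comm)
  show "closed (range T')"
    unfolding closed_sequential_limits
  proof safe
    fix f y assume f: "\<forall>n. f n \<in> range T'" and lim: "f \<longlonglongrightarrow> y"
    have "(T ^^ d) (f n) \<in> T' ` range (T ^^ d)" for n
    proof -
      obtain x where "f n = T' x" using f by blast
      then show ?thesis by (simp add: commd)
    qed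
    moreover have "(\<lambda>n. (T ^^ d) (f n)) \<longlonglongrightarrow> (T ^^ d) y"
      by (rule bounded_linear.tendsto[OF bounded_linear_funpow[OF T] lim])
    ultimately have "(T ^^ d) y \<in> T' ` range (T ^^ d)"
      by (rule closed_sequentially[OF W(1)])
    then have "(T ^^ d) y \<in> range T'" by blast
    then show "y \<in> range T'" by (rule descend)
  qed
qed

lemma right_subspace_imp_subspace:
  assumes "right_subspace M"
  shows "subspace M"
proof (rule subspaceI)
  show "c *\<^sub>R x \<in> M" if "x \<in> M" for c x
    using assms that unfolding right_subspace_def by (metis scaleH_of_real)
qed (use assms in \<open>auto simp: right_subspace_def\<close>)

text \<open>Since \<open>T ^^ d\<close> kills \<open>N\<close>, its range is the image of \<open>M\<close> under \<open>T ^^ d\<close>, and semi-regularity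
  passes from \<open>M\<close> to this image. In contrast to \<open>M\<close>, the range of \<open>T ^^ d\<close> is invariant under every
  operator that commutes with \<open>T\<close>.\<close>

lemma kato_type_power_range:
  fixes T :: "'a::right_quat_hilbert \<Rightarrow> 'a"
  assumes T: "bounded_linear T" and gkd: "is_GKD T M N" and nil: "\<And>x. x \<in> N \<Longrightarrow> (T ^^ d) x = 0"
  shows "semi_regular_restriction T (range (T ^^ d))"
proof -
  interpret M: semi_regular_restriction T M
    using gkd T unfolding is_GKD_def semi_regular_on_def
    by (intro semi_regular_restriction.intro) (auto intro: right_subspace_imp_subspace)
  have W: "range (T ^^ d) = (T ^^ d) ` M"
  proof
    show "range (T ^^ d) \<subseteq> (T ^^ d) ` M"
    proof safe
      fix x
      obtain m n where mn: "m \<in> M" "n \<in> N" "x = m + n" using gkd unfolding is_GKD_def by blast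
      then have "(T ^^ d) x = (T ^^ d) m"
        using nil by (simp add: linear_add[OF bounded_linear.linear[OF bounded_linear_funpow[OF T]]])
      then show "(T ^^ d) x \<in> (T ^^ d) ` M" using mn by blast
    qed
  qed auto
  show ?thesis
  proof (rule semi_regular_restriction.intro)
    show "bounded_linear T" by (rule T)
    show "subspace (range (T ^^ d))" "closed (range (T ^^ d))"
      unfolding W by (rule M.powers_subspace M.powers_closed)+
    show "T ` range (T ^^ d) \<subseteq> range (T ^^ d)" by (auto simp: funpow_swap1)
    show "closed (T ` range (T ^^ d))"
      using M.powers_closed[of "Suc d"] by (simp add: W image_comp)
    show "{x \<in> range (T ^^ d). T x = 0} \<subseteq> (\<Inter>n. (T ^^ n) ` range (T ^^ d))"
    proof (intro subsetI INT_I)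
      fix x n assume x: "x \<in> {x \<in> range (T ^^ d). T x = 0}"
      then have "x \<in> {x \<in> M. T x = 0}"
        using funpow_image_subset[OF M.W(3), of d] unfolding W by blast
      from INT_D[OF subsetD[OF M.kernel this] UNIV_I, of "n + d"]
      have "x \<in> (T ^^ (n + d)) ` M" .
      then show "x \<in> (T ^^ n) ` range (T ^^ d)" by (simp add: W image_comp funpow_add)
    qed
  qed
qed

section \<open>Quasi-nilpotent operators on finite dimensional spaces\<close>

lemma onorm_on:
  fixes F :: "'a::right_quat_hilbert \<Rightarrow> 'a"
  assumes F: "bounded_linear F" and N: "0 \<in> N"
  shows "0 \<le> onorm_on N F" and "x \<in> N \<Longrightarrow> norm (F x) \<le> onorm_on N F * norm x"
proof -
  have bdd: "bdd_above ((\<lambda>x. norm (F x) / norm x) ` N)"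
    by (rule bdd_aboveI[of _ "onorm F"]) (auto intro: le_onorm[OF F])
  have le: "norm (F x) / norm x \<le> onorm_on N F" if "x \<in> N" for x
    unfolding onorm_on_def by (rule cSUP_upper[OF that bdd])
  show "0 \<le> onorm_on N F" using le[OF N] by simp
  show "norm (F x) \<le> onorm_on N F * norm x" if "x \<in> N"
    using le[OF that] linear_0[OF bounded_linear.linear[OF F]] by (cases "x = 0") (auto simp: divide_simps)
qed

lemma finite_span_relation:
  fixes f :: "nat \<Rightarrow> 'a::real_vector"
  assumes E: "finite E" and f: "\<And>i. f i \<in> span E"
  shows "\<exists>c. (\<exists>i\<le>card E. c i \<noteq> 0) \<and> (\<Sum>i\<le>card E. c i *\<^sub>R f i) = 0"
proof (cases "inj_on f {..card E}")
  case True
  have "card (f ` {..card E}) = Suc (card E)" using True by (simp add: card_image)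
  moreover have "f ` {..card E} \<subseteq> span E" using f by blast
  ultimately have "dependent (f ` {..card E})"
    using real_vector.independent_span_bound[OF E, of "f ` {..card E}"] by linarith
  then obtain u where u: "\<exists>v\<in>f ` {..card E}. u v \<noteq> 0" "(\<Sum>v\<in>f ` {..card E}. u v *\<^sub>R v) = 0"
    using real_vector.dependent_finite[of "f ` {..card E}"] by auto
  then show ?thesis using True by (intro exI[of _ "u \<circ> f"]) (auto simp: sum.reindex)
next
  case False
  then obtain i j where ij: "i \<le> card E" "j \<le> card E" "i \<noteq> j" "f i = f j"
    by (auto simp: inj_on_def)
  define c :: "nat \<Rightarrow> real" where "c k = (if k = i then 1 else if k = j then -1 else 0)" for k
  have "(\<Sum>k\<le>card E. c k *\<^sub>R f k) = (\<Sum>k\<in>{i, j}. c k *\<^sub>R f k)"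
    using ij by (intro sum.mono_neutral_right) (auto simp: c_def)
  also have "\<dots> = 0" using ij by (simp add: c_def)
  finally show ?thesis using ij by (intro exI[of _ c]) (auto simp: c_def)
qed

text \<open>Iterating \<open>z = B (G z)\<close> gives \<open>z = (B ^^ n) ((G ^^ n) z)\<close>. The norm of \<open>G ^^ n\<close> grows at most
  geometrically, and that of \<open>B ^^ n\<close> on \<open>N\<close> decays faster than any geometric sequence.\<close>

lemma quasi_nilpotent_on_factor_imp_zero:
  fixes B :: "'a::right_quat_hilbert \<Rightarrow> 'a"
  assumes B: "bounded_linear B" and qn: "quasi_nilpotent_on N B" and N: "0 \<in> N"
    and G: "bounded_linear G" "G ` N \<subseteq> N" "\<And>x. G (B x) = B (G x)"
    and z: "z \<in> N" "z = B (G z)"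
  shows "z = 0"
proof -
  obtain g where g: "g > 0" "\<And>x. norm (G x) \<le> norm x * g"
    using bounded_linear.pos_bounded[OF G(1)] by blast
  have G_pow: "norm ((G ^^ n) z) \<le> g ^ n * norm z" for n
  proof (induction n)
    case (Suc n)
    have "norm ((G ^^ Suc n) z) \<le> norm ((G ^^ n) z) * g" by (simp add: g)
    also have "\<dots> \<le> (g ^ n * norm z) * g" using Suc g by (intro mult_right_mono) auto
    finally show ?case by (simp add: mult_ac)
  qed simp
  have comm: "(G ^^ n) (B x) = B ((G ^^ n) x)" for n x
    by (induction n) (simp_all add: G)
  have fact: "z = (B ^^ n) ((G ^^ n) z)" for n
  proof (induction n)
    case (Suc n)
    have "(G ^^ n) z = (G ^^ n) (B (G z))" using z(2) by (rule arg_cong)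
    also have "\<dots> = B ((G ^^ Suc n) z)" by (simp only: comm funpow_Suc_right comp_apply)
    finally have "(B ^^ n) ((G ^^ n) z) = (B ^^ Suc n) ((G ^^ Suc n) z)"
      by (simp only: funpow_Suc_right comp_apply)
    then show ?case using Suc by simp
  qed simp
  define o' where "o' n = onorm_on N (B ^^ n)" for n
  have "(\<lambda>n. root n (o' n)) \<longlonglongrightarrow> 0" using qn by (simp add: quasi_nilpotent_on_def o'_def)
  then have "\<forall>\<^sub>F n in sequentially. root n (o' n) < 1 / (2 * g)"
    using g(1) by (intro order_tendstoD(2)) auto
  then have "\<forall>\<^sub>F n in sequentially. root n (o' n) < 1 / (2 * g) \<and> n \<ge> 1"
    using eventually_ge_at_top by (rule eventually_conj)
  then obtain n where n: "root n (o' n) < 1 / (2 * g)" "n \<ge> 1"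
    using eventually_happens'[OF sequentially_bot] by blast
  have o0: "o' n \<ge> 0" unfolding o'_def by (rule onorm_on(1)[OF bounded_linear_funpow[OF B] N])
  have "o' n = root n (o' n) ^ n" using n o0 by (simp add: real_root_pow_pos2)
  also have "\<dots> \<le> (1 / (2 * g)) ^ n" using n o0 by (intro power_mono) auto
  finally have o_le: "o' n \<le> (1 / (2 * g)) ^ n" .
  have "(G ^^ n) z \<in> N" using funpow_image_subset[OF G(2)] z(1) by blast
  then have "norm z \<le> o' n * norm ((G ^^ n) z)"
    using onorm_on(2)[OF bounded_linear_funpow[OF B] N] fact[of n] unfolding o'_def by metis
  also have "\<dots> \<le> (1 / (2 * g)) ^ n * (g ^ n * norm z)"
    using G_pow o_le o0 g by (intro mult_mono) auto
  also have "\<dots> = (1 / 2) ^ n * norm z"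
    using g(1) by (simp add: power_mult_distrib power_divide)
  also have "\<dots> \<le> (1 / 2) ^ 1 * norm z"
    using n(2) by (intro mult_right_mono power_decreasing) auto
  finally show ?thesis by simp
qed

text \<open>The vectors \<open>x, B x, \<dots>, (B ^^ card E) x\<close> satisfy a nontrivial linear relation. If \<open>j\<close> is the
  lowest exponent in it, the relation expresses \<open>z = (B ^^ j) x\<close> as \<open>B (G z)\<close> with \<open>G\<close> a polynomial in \<open>B\<close>,
  which forces \<open>z = 0\<close>.\<close>

lemma quasi_nilpotent_finite_dim_imp_nilpotent:
  fixes B :: "'a::right_quat_hilbert \<Rightarrow> 'a"
  assumes B: "bounded_linear B" and N: "subspace N" "B ` N \<subseteq> N"
    and E: "finite E" "N \<subseteq> span E" and qn: "quasi_nilpotent_on N B" and x: "x \<in> N"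
  shows "(B ^^ card E) x = 0"
proof -
  define k where "k = card E"
  have pow_N: "(B ^^ i) y \<in> N" if "y \<in> N" for i y
    using funpow_image_subset[OF N(2)] that by blast
  have B_pow: "linear (B ^^ i)" for i
    by (rule bounded_linear.linear[OF bounded_linear_funpow[OF B]])
  obtain c where c: "\<exists>i\<le>k. c i \<noteq> 0" "(\<Sum>i\<le>k. c i *\<^sub>R (B ^^ i) x) = 0"
    using finite_span_relation[OF E(1), of "\<lambda>i. (B ^^ i) x"] pow_N[OF x] E(2) unfolding k_def by blast
  define j where "j = (LEAST i. c i \<noteq> 0)"
  have cj: "c j \<noteq> 0" unfolding j_def using c(1) by (metis (mono_tags) LeastI)
  have below: "c i = 0" if "i < j" for i using that not_less_Least unfolding j_def by blast
  have jk: "j \<le> k" using c(1) below by (meson leI le_trans less_imp_le)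
  define z where "z = (B ^^ j) x"
  define G where "G y = (\<Sum>i\<in>{j<..k}. (- c i / c j) *\<^sub>R (B ^^ (i - Suc j)) y)" for y
  have G: "bounded_linear G"
    unfolding G_def
    using bounded_linear_compose[OF bounded_linear_scaleR_right bounded_linear_funpow[OF B]]
    by (intro bounded_linear_sum)
  have GN: "G ` N \<subseteq> N"
    unfolding G_def using pow_N by (intro image_subsetI subspace_sum[OF N(1)] subspace_scale[OF N(1)])
  have lB: "linear B" by (rule bounded_linear.linear[OF B])
  have B_G: "B (G y) = (\<Sum>i\<in>{j<..k}. (- c i / c j) *\<^sub>R B ((B ^^ (i - Suc j)) y))" for y
    unfolding G_def by (simp only: linear_sum[OF lB] linear_scale[OF lB])
  have comm: "G (B y) = B (G y)" for y
    unfolding B_G by (simp add: G_def funpow_swap1)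
  have "B (G z) = (\<Sum>i\<in>{j<..k}. (- c i / c j) *\<^sub>R (B ^^ i) x)"
    unfolding B_G
  proof (rule sum.cong)
    fix i assume i: "i \<in> {j<..k}"
    then have "i = Suc (i - Suc j) + j" by simp
    then have "(B ^^ i) x = (B ^^ Suc (i - Suc j)) ((B ^^ j) x)" by (metis funpow_add comp_apply)
    then show "(- c i / c j) *\<^sub>R B ((B ^^ (i - Suc j)) z) = (- c i / c j) *\<^sub>R (B ^^ i) x"
      by (simp add: z_def)
  qed simp
  also have "\<dots> = (- 1 / c j) *\<^sub>R (\<Sum>i\<in>{j<..k}. c i *\<^sub>R (B ^^ i) x)"
    by (simp add: scaleR_sum_right)
  also have "(\<Sum>i\<in>{j<..k}. c i *\<^sub>R (B ^^ i) x) = - (c j *\<^sub>R z)"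
  proof -
    have "(\<Sum>i\<le>k. c i *\<^sub>R (B ^^ i) x) = (\<Sum>i\<in>{j..k}. c i *\<^sub>R (B ^^ i) x)"
      using below by (intro sum.mono_neutral_right) (auto simp: not_le)
    also have "{j..k} = insert j {j<..k}" using jk by auto
    also have "(\<Sum>i\<in>insert j {j<..k}. c i *\<^sub>R (B ^^ i) x) = c j *\<^sub>R z + (\<Sum>i\<in>{j<..k}. c i *\<^sub>R (B ^^ i) x)"
      by (subst sum.insert) (auto simp: z_def)
    finally show ?thesis using c(2) by (simp add: eq_neg_iff_add_eq_0 add.commute)
  qed
  finally have "z = B (G z)" using cj by simp
  then have "z = 0"
    using quasi_nilpotent_on_factor_imp_zero[OF B qn subspace_0[OF N(1)] G GN comm] pow_N[OF x]
    by (simp add: z_def)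
  have "(B ^^ k) x = (B ^^ (k - j)) z"
    unfolding z_def using jk by (metis funpow_add comp_apply le_add_diff_inverse2)
  then show ?thesis using \<open>z = 0\<close> linear_0[OF B_pow] by (simp add: k_def)
qed


section \<open>Quaternions and finite right dimension\<close>

text \<open>This makes bounded closed sets of quaternions compact and gives a countable topological basis.\<close>

instantiation quat :: euclidean_space
begin

definition "Basis = {Quat 1 0 0 0, Quat 0 1 0 0, Quat 0 0 1 0, Quat 0 0 0 1}"

instance
proof
  fix x u v :: quat
  show "(Basis :: quat set) \<noteq> {}" "finite (Basis :: quat set)" by (simp_all add: Basis_quat_def)
  show "u \<bullet> v = (if u = v then 1 else 0)" if "u \<in> Basis" "v \<in> Basis"
    using that unfolding Basis_quat_def by (elim insertE emptyE) (simp_all add: inner_quat_def)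
  show "(\<forall>u\<in>Basis. x \<bullet> u = 0) \<longleftrightarrow> x = 0"
    by (cases x) (simp add: Basis_quat_def inner_quat_def zero_quat_def)
qed

end

lemma qRe_eq_inner: "qRe q = q \<bullet> 1"
  by (simp add: inner_quat_def one_quat_def)

lemma abs_qRe_le: "\<bar>qRe q\<bar> \<le> norm q"
  using Basis_le_norm[of 1 q] by (simp add: qRe_eq_inner Basis_quat_def one_quat_def)

lemma qRe_sq_le: "(qRe q)\<^sup>2 \<le> (norm q)\<^sup>2"
  by (simp add: norm_quat_def)

lemma linear_scaleH_right: "linear (\<lambda>p. x \<cdot>\<^sub>H p)"
proof (rule linearI)
  fix r :: real and p
  have "x \<cdot>\<^sub>H (r *\<^sub>R p) = x \<cdot>\<^sub>H (p * of_real r)" by (simp add: of_real_def)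
  then show "x \<cdot>\<^sub>H (r *\<^sub>R p) = r *\<^sub>R (x \<cdot>\<^sub>H p)" by (simp add: scaleH_of_real flip: scaleH_scaleH)
qed (rule scaleH_add_right)

lemma linear_scaleH_left: "linear (\<lambda>x. x \<cdot>\<^sub>H q)"
proof (rule linearI)
  fix r :: real and x :: 'a
  have "(r *\<^sub>R x) \<cdot>\<^sub>H q = x \<cdot>\<^sub>H (of_real r * q)" by (simp add: scaleH_of_real flip: scaleH_scaleH)
  also have "of_real r * q = r *\<^sub>R q" by (simp add: of_real_def)
  finally show "(r *\<^sub>R x) \<cdot>\<^sub>H q = r *\<^sub>R (x \<cdot>\<^sub>H q)"
    by (simp add: linear_scale[OF linear_scaleH_right])
qed (rule scaleH_add_left)

text \<open>Over the reals, right multiples of a vector by the four quaternion units span its quaternionic line.\<close>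

lemma right_finite_dim_imp_real_span:
  assumes "right_finite_dim N"
  shows "\<exists>E. finite E \<and> N \<subseteq> span E"
proof -
  obtain S where S: "finite S" "N = right_subspace hull S"
    using assms unfolding right_finite_dim_def by blast
  define E where "E = (\<lambda>(s, u). s \<cdot>\<^sub>H u) ` (S \<times> Basis)"
  have gen: "s \<cdot>\<^sub>H p \<in> span E" if "s \<in> S" for s p
  proof -
    have "s \<cdot>\<^sub>H p = s \<cdot>\<^sub>H (\<Sum>u\<in>Basis. (p \<bullet> u) *\<^sub>R u)" by (simp only: euclidean_representation)
    also have "\<dots> = (\<Sum>u\<in>Basis. (p \<bullet> u) *\<^sub>R (s \<cdot>\<^sub>H u))"
      by (simp only: linear_sum[OF linear_scaleH_right] linear_scale[OF linear_scaleH_right])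
    also have "\<dots> \<in> span E"
      using that by (intro span_sum span_scale span_base) (auto simp: E_def)
    finally show ?thesis .
  qed
  have "x \<cdot>\<^sub>H q \<in> span E" if "x \<in> span E" for x q
    using that
  proof (induction rule: span_induct_alt)
    case base
    then show ?case by (simp add: linear_0[OF linear_scaleH_left] span_zero)
  next
    case (step c x y)
    then obtain s u where "s \<in> S" "x = s \<cdot>\<^sub>H u" by (auto simp: E_def)
    then have "x \<cdot>\<^sub>H q \<in> span E" using gen by (simp add: scaleH_scaleH)
    then show ?case using step
      by (simp add: linear_add[OF linear_scaleH_left] linear_scale[OF linear_scaleH_left] span_add span_scale)
  qed
  then have "right_subspace (span E)"
    by (simp add: right_subspace_def span_zero span_add)
  moreover have "S \<subseteq> span E"
  proof
    show "s \<in> span E" if "s \<in> S" for s using gen[OF that, of "of_real 1"] by (simp add: scaleH_of_real del: of_real_1)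
  qed
  ultimately have "N \<subseteq> span E" unfolding S(2) by (rule hull_minimal[rotated])
  moreover have "finite E" using S(1) by (simp add: E_def)
  ultimately show ?thesis by blast
qed

lemma right_subspace_singleton_0: "right_subspace {0}"
  unfolding right_subspace_def using linear_0[OF linear_scaleH_left] by auto

lemma right_finite_dim_singleton_0: "right_finite_dim {0}"
proof -
  have "right_subspace hull {} = {0::'a}"
  proof
    show "right_subspace hull {} \<subseteq> {0::'a}"
      by (rule hull_minimal) (auto simp: right_subspace_singleton_0)
    show "{0::'a} \<subseteq> right_subspace hull {}"
      unfolding hull_def by (auto simp: right_subspace_def)
  qed
  then show ?thesis unfolding right_finite_dim_def by (metis finite.emptyI)
qed

section \<open>Implications between the classes of operators\<close>

lemma quasi_nilpotent_on_singleton_0: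
  assumes "B 0 = 0"
  shows "quasi_nilpotent_on {0} B"
proof -
  have "onorm_on {0} (B ^^ n) = 0" for n by (simp add: onorm_on_def)
  then show ?thesis by (simp add: quasi_nilpotent_on_def)
qed

lemma semi_regular_imp_trivial_GKD:
  assumes "semi_regular B" "B 0 = 0"
  shows "is_GKD B UNIV {0}"
  using assms right_subspace_singleton_0 quasi_nilpotent_on_singleton_0
  by (auto simp: is_GKD_def right_subspace_def)

lemma semi_regular_imp_kato_type:
  assumes "semi_regular B" "B 0 = 0"
  shows "kato_type B"
proof -
  have "\<forall>x\<in>{0}. (B ^^ 0) x = 0" by simp
  then show ?thesis using semi_regular_imp_trivial_GKD[OF assms] unfolding kato_type_def by blast
qed

lemma semi_regular_imp_essentially_semi_regular:
  assumes "semi_regular B" "B 0 = 0"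
  shows "essentially_semi_regular B"
  using semi_regular_imp_trivial_GKD[OF assms] right_finite_dim_singleton_0
  unfolding essentially_semi_regular_def by blast

lemma essentially_semi_regular_imp_kato_type:
  assumes B: "bounded_linear B" and ess: "essentially_semi_regular B"
  shows "kato_type B"
proof -
  obtain M N where gkd: "is_GKD B M N" and fin: "right_finite_dim N"
    using ess unfolding essentially_semi_regular_def by blast
  obtain E where E: "finite E" "N \<subseteq> span E" using right_finite_dim_imp_real_span[OF fin] by blast
  have "\<forall>x\<in>N. (B ^^ card E) x = 0"
    using gkd quasi_nilpotent_finite_dim_imp_nilpotent[OF B right_subspace_imp_subspace _ E]
    unfolding is_GKD_def by blast
  with gkd show ?thesis unfolding kato_type_def by blast
qed

section \<open>Punctured neighbourhoods and the inclusions between the spectra\<close>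

lemma bounded_linear_R_op:
  assumes A: "bounded_linear A"
  shows "bounded_linear (R_op q A)"
  unfolding R_op_def
  by (intro bounded_linear_add bounded_linear_sub bounded_linear_compose[OF A A] A bounded_linear_ident
      bounded_linear_compose[OF bounded_linear_scaleR_right])

lemma R_op_0: "bounded_linear A \<Longrightarrow> R_op q A 0 = 0"
  using linear_0[OF bounded_linear.linear[OF bounded_linear_R_op]] .

lemma R_op_qsphere: "p \<in> qsphere q \<Longrightarrow> R_op p A = R_op q A"
  by (simp add: qsphere_def R_op_def)

lemma qsphere_self: "q \<in> qsphere q"
  by (simp add: qsphere_def)

text \<open>If \<open>C\<close> is a lifting bound of \<open>T = R_op q A\<close> on the range of \<open>T ^^ d\<close>, the neighbourhood
  consists of the \<open>p\<close> for which a bound \<open>s p\<close> on the norm of \<open>R_op p A - R_op q A\<close> is below \<open>1 / (2 * C)\<close>.\<close>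

lemma kato_type_imp_punctured_semi_regular:
  fixes A :: "'a::right_quat_hilbert \<Rightarrow> 'a"
  assumes A: "bounded_linear A" and kato: "kato_type (R_op q A)"
  shows "\<exists>U. open U \<and> qsphere q \<subseteq> U \<and> (\<forall>p\<in>U - qsphere q. semi_regular (R_op p A))"
proof -
  have lA: "linear A" by (rule bounded_linear.linear[OF A])
  define T where "T = R_op q A"
  have T: "bounded_linear T" unfolding T_def by (rule bounded_linear_R_op[OF A])
  obtain M N d where "is_GKD T M N" "\<forall>x\<in>N. (T ^^ d) x = 0"
    using kato unfolding kato_type_def T_def by blast
  then interpret W: semi_regular_restriction T "range (T ^^ d)"
    using kato_type_power_range[OF T] by blast
  obtain C where C: "lifting_bound C T (range (T ^^ d))"
    using closed_image_imp_lifting_bound[OF T W.W(1,2) W.closed_range] by blast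
  then have C0: "C > 0" by (simp add: lifting_bound_def)
  obtain K where K: "K > 0" "\<And>x. norm (A x) \<le> norm x * K"
    using bounded_linear.pos_bounded[OF A] by blast
  define s where "s p = 2 * \<bar>qRe p - qRe q\<bar> * K + \<bar>(norm p)\<^sup>2 - (norm q)\<^sup>2\<bar>" for p :: quat
  define U where "U = {p. s p < 1 / (2 * C)}"
  have "open U"
    unfolding U_def s_def qRe_eq_inner by (intro open_Collect_less continuous_intros)
  moreover have "qsphere q \<subseteq> U" using C0 by (auto simp: U_def s_def qsphere_def)
  moreover have "semi_regular (R_op p A)" if p: "p \<in> U - qsphere q" for p
  proof -
    define T' where "T' = R_op p A"
    have T': "bounded_linear T'" unfolding T'_def by (rule bounded_linear_R_op[OF A])
    define S where "S x = (- 2 * (qRe p - qRe q)) *\<^sub>R A x + ((norm p)\<^sup>2 - (norm q)\<^sup>2) *\<^sub>R x" for x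
    have S: "bounded_linear S"
      unfolding S_def
      by (intro bounded_linear_add bounded_linear_ident A
          bounded_linear_compose[OF bounded_linear_scaleR_right])
    have T_S: "T' = (\<lambda>x. T x + S x)"
      by (rule ext) (simp add: T_def T'_def S_def R_op_def algebra_simps)
    have A_T: "A (T x) = T (A x)" "A (T' x) = T' (A x)" for x
      by (simp_all add: T_def T'_def R_op_def linear_add[OF lA] linear_diff[OF lA] linear_scale[OF lA])
    have comb: "a *\<^sub>R F x + b *\<^sub>R A (F x) = F (a *\<^sub>R x + b *\<^sub>R A x)"
      if "linear F" "\<And>x. A (F x) = F (A x)" for a b x and F :: "'a \<Rightarrow> 'a"
      by (simp only: that(2) linear_add[OF that(1)] linear_scale[OF that(1)])
    have S_T: "S (T x) = T (S x)" for x
      unfolding S_def A_T(1) by (simp only: linear_add[OF bounded_linear.linear[OF T]]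
          linear_scale[OF bounded_linear.linear[OF T]])
    have S_pow: "S ((T ^^ d) x) = (T ^^ d) (S x)" for x
      by (rule funpow_commute_on[where W = UNIV]) (simp_all add: S_T)
    have S_le: "norm (S x) \<le> s p * norm x" for x
    proof -
      have coeff: "\<bar>- 2 * (qRe p - qRe q)\<bar> = 2 * \<bar>qRe p - qRe q\<bar>" by (simp only: abs_mult abs_neg_numeral)
      have "norm (S x) \<le> 2 * \<bar>qRe p - qRe q\<bar> * norm (A x) + \<bar>(norm p)\<^sup>2 - (norm q)\<^sup>2\<bar> * norm x"
        unfolding S_def by (rule norm_triangle_le) (simp only: norm_scaleR coeff order_refl)
      also have "2 * \<bar>qRe p - qRe q\<bar> * norm (A x) \<le> 2 * \<bar>qRe p - qRe q\<bar> * (norm x * K)"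
        by (intro mult_left_mono K) auto
      finally show ?thesis by (simp add: s_def algebra_simps)
    qed
    have s0: "s p \<ge> 0" using K(1) by (simp add: s_def)
    have "C * s p \<le> 1 / 2" using p C0 by (simp add: U_def field_simps)
    have S_W: "S ` range (T ^^ d) \<subseteq> range (T ^^ d)" by (auto simp: S_pow)
    have W': "closed (T' ` range (T ^^ d))"
      "{x \<in> range (T ^^ d). T' x = 0} \<subseteq> (\<Inter>n. (T' ^^ n) ` range (T ^^ d))"
      unfolding T_S
      by (rule W.small_commuting_perturbation[OF C S S_W S_T S_le s0 \<open>C * s p \<le> 1 / 2\<close>])+
    have "(qRe q, (norm q)\<^sup>2) \<noteq> (qRe p, (norm p)\<^sup>2)"
      using p by (auto simp: qsphere_def)
    from quadratic_bezout[OF lA qRe_sq_le qRe_sq_le this]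
    obtain c0 c1 d0 d1 where bez:
      "\<And>x. (d0 *\<^sub>R T' x + d1 *\<^sub>R A (T' x)) + (c0 *\<^sub>R T x + c1 *\<^sub>R A (T x)) = x"
      unfolding T_def T'_def R_op_def by blast
    define \<alpha> \<beta> where "\<alpha> x = d0 *\<^sub>R x + d1 *\<^sub>R A x" and "\<beta> x = c0 *\<^sub>R x + c1 *\<^sub>R A x" for x
    have lin: "linear (\<lambda>x. a *\<^sub>R x + b *\<^sub>R A x)" for a b
      by (rule linearI) (simp_all add: linear_add[OF lA] linear_scale[OF lA] algebra_simps)
    have T_T': "T (T' x) = T' (T x)" for x
      unfolding T_S by (simp only: S_T linear_add[OF bounded_linear.linear[OF T]])
    have ab: "\<alpha> (T' x) = T' (\<alpha> x)" "\<beta> (T' x) = T' (\<beta> x)" "\<beta> (T x) = T (\<beta> x)" for x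
      unfolding \<alpha>_def \<beta>_def
      by (simp_all only: comb[OF bounded_linear.linear[OF T'] A_T(2)]
          comb[OF bounded_linear.linear[OF T] A_T(1)])
    have "linear \<alpha>" "linear \<beta>" unfolding \<alpha>_def \<beta>_def by (rule lin)+
    moreover have "\<alpha> (T' x) + \<beta> (T x) = x" for x unfolding \<alpha>_def \<beta>_def by (rule bez)
    ultimately have "closed (range T')" "{x. T' x = 0} \<subseteq> (\<Inter>n. range (T' ^^ n))"
      using semi_regular_extends_from_power_range[where T = T and T' = T' and d = d
          and \<alpha> = \<alpha> and \<beta> = \<beta>] T T' T_T' ab W' by simp_all
    then show ?thesis by (simp add: semi_regular_on_def T'_def)
  qed
  ultimately show ?thesis by blast
qed

lemma bounded_below_imp_semi_regular:
  assumes B: "bounded_linear B" and c: "c > 0" "\<And>x. c * norm x \<le> norm (B x)"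
  shows "semi_regular B"
proof -
  have B0: "B 0 = 0" by (rule linear_0[OF bounded_linear.linear[OF B]])
  have "norm x \<le> 1 / c * norm (B x)" for x using c by (simp add: field_simps)
  then have "lifting_bound (1 / c) B UNIV" using c by (auto simp: lifting_bound_def)
  then have "closed (range B)" by (intro lifting_bound_imp_closed[OF B]) auto
  moreover have "x = 0" if "B x = 0" for x
    using c(2)[of x] c(1) that by (simp add: mult_le_0_iff)
  moreover have "(B ^^ n) 0 = 0" for n by (induction n) (simp_all add: B0)
  then have "0 \<in> range (B ^^ n)" for n by (metis rangeI)
  ultimately show ?thesis by (auto simp: semi_regular_on_def)
qed

lemma bounded_kato_S_spectrum:
  assumes A: "bounded_linear A"
  shows "bounded (kato_S_spectrum A)"
proof -
  obtain K where K: "K > 0" "\<And>x. norm (A x) \<le> norm x * K"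
    using bounded_linear.pos_bounded[OF A] by blast
  have "semi_regular (R_op q A)" if q: "norm q > 3 * K" for q
  proof (rule bounded_below_imp_semi_regular[OF bounded_linear_R_op[OF A]])
    define n where "n = norm q"
    have n: "n > 3 * K" using q by (simp add: n_def)
    show "K\<^sup>2 > 0" using K by simp
    fix x
    have 1: "norm (A (A x)) \<le> K\<^sup>2 * norm x"
      using order_trans[OF K(2)[of "A x"] mult_right_mono[OF K(2)[of x], of K]] K(1)
      by (simp add: power2_eq_square mult_ac)
    have "\<bar>qRe q\<bar> \<le> n" unfolding n_def by (rule abs_qRe_le)
    then have "norm ((2 * qRe q) *\<^sub>R A x) \<le> (2 * n) * (norm x * K)"
      unfolding norm_scaleR using K by (intro mult_mono) auto
    moreover have "norm (n\<^sup>2 *\<^sub>R x) \<le> norm (R_op q A x) + norm (A (A x)) + norm ((2 * qRe q) *\<^sub>R A x)"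
    proof -
      have "n\<^sup>2 *\<^sub>R x = R_op q A x - A (A x) + (2 * qRe q) *\<^sub>R A x" by (simp add: R_op_def n_def)
      then show ?thesis
        using norm_triangle_ineq[of "R_op q A x - A (A x)" "(2 * qRe q) *\<^sub>R A x"]
          norm_triangle_ineq4[of "R_op q A x" "A (A x)"] by (simp only:)
    qed
    ultimately have 2: "(n\<^sup>2 - 2 * n * K - K\<^sup>2) * norm x \<le> norm (R_op q A x)"
      using 1 by (simp add: algebra_simps)
    have "n * (n - 2 * K) \<ge> 3 * K * K" using n K(1) by (intro mult_mono) auto
    then have "K\<^sup>2 \<le> n\<^sup>2 - 2 * n * K - K\<^sup>2"
      using mult_pos_pos[OF K(1) K(1)] by (simp add: power2_eq_square algebra_simps)
    then have "K\<^sup>2 * norm x \<le> (n\<^sup>2 - 2 * n * K - K\<^sup>2) * norm x" by (rule mult_right_mono) simp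
    then show "K\<^sup>2 * norm x \<le> norm (R_op q A x)" using 2 by linarith
  qed
  then have "norm q \<le> 3 * K" if "q \<in> kato_S_spectrum A" for q
    using that by (auto simp: kato_S_spectrum_def not_less[symmetric])
  then show ?thesis unfolding bounded_iff by blast
qed

lemma kato_S_spectrum_subset_S_spectrum: "bounded_linear A \<Longrightarrow> kato_S_spectrum A \<subseteq> S_spectrum A"
proof
  fix q assume A: "bounded_linear A" and q: "q \<in> kato_S_spectrum A"
  show "q \<in> S_spectrum A"
  proof (rule ccontr)
    assume "q \<notin> S_spectrum A"
    then obtain B where B: "bounded_right_linear B" "B \<circ> R_op q A = id"
      unfolding S_spectrum_def by blast
    then obtain K where K: "K > 0" "\<And>x. norm (B x) \<le> norm x * K"
      using bounded_linear.pos_bounded unfolding bounded_right_linear_def by blast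
    have "1 / K * norm x \<le> norm (R_op q A x)" for x
      using K(2)[of "R_op q A x"] pointfree_idE[OF B(2), of x] K(1) by (simp add: field_simps)
    then have "semi_regular (R_op q A)"
      using bounded_below_imp_semi_regular[OF bounded_linear_R_op[OF A], of "1 / K"] K(1) by simp
    then show False using q by (simp add: kato_S_spectrum_def)
  qed
qed

lemma gen_kato_subset_ess:
  assumes A: "bounded_linear A"
  shows "gen_kato_S_spectrum A \<subseteq> ess_semi_regular_S_spectrum A"
  unfolding gen_kato_S_spectrum_def ess_semi_regular_S_spectrum_def
  by (intro Collect_mono impI) (erule contrapos_nn,
      rule essentially_semi_regular_imp_kato_type[OF bounded_linear_R_op[OF A]])

lemma ess_subset_kato:
  assumes A: "bounded_linear A"
  shows "ess_semi_regular_S_spectrum A \<subseteq> kato_S_spectrum A"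
  unfolding kato_S_spectrum_def ess_semi_regular_S_spectrum_def
  by (intro Collect_mono impI) (erule contrapos_nn,
      rule semi_regular_imp_essentially_semi_regular, assumption, rule R_op_0[OF A])

section \<open>Closedness and isolated spheres\<close>

text \<open>The property \<open>P\<close> stands for being of Kato type, or for being essentially semi-regular.
  Near a point of the complement of \<open>X\<close>, \<open>P\<close> holds off the sphere by semi-regularity, and on the
  sphere because the operator is the same.\<close>

lemma closed_if_between_semi_regular_and_kato_type:
  fixes A :: "'a::right_quat_hilbert \<Rightarrow> 'a"
  assumes A: "bounded_linear A" and X: "X = {q. \<not> P (R_op q A)}"
    and kato: "\<And>q. P (R_op q A) \<Longrightarrow> kato_type (R_op q A)"
    and reg: "\<And>q. semi_regular (R_op q A) \<Longrightarrow> P (R_op q A)"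
  shows "closed X"
proof -
  have "\<exists>T. open T \<and> q \<in> T \<and> T \<subseteq> - X" if "q \<in> - X" for q
  proof -
    have q: "P (R_op q A)" using that by (simp add: X)
    obtain U where U: "open U" "qsphere q \<subseteq> U" "\<And>p. p \<in> U - qsphere q \<Longrightarrow> semi_regular (R_op p A)"
      using kato_type_imp_punctured_semi_regular[OF A kato[OF q]] by blast
    have "P (R_op p A)" if "p \<in> U" for p
      using U(3)[of p] reg[of p] q R_op_qsphere[of p q A] that by (cases "p \<in> qsphere q") auto
    then have "U \<subseteq> - X" by (auto simp: X)
    then show ?thesis using U qsphere_self by blast
  qed
  then have "open (- X)" by (subst open_subopen) blast
  then show ?thesis by (simp add: closed_def)
qed

lemma isolated_off_gen_kato_S_spectrum:
  fixes A :: "'a::right_quat_hilbert \<Rightarrow> 'a"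
  assumes A: "bounded_linear A" and X: "X = {q. \<not> P (R_op q A)}"
    and reg: "\<And>q. semi_regular (R_op q A) \<Longrightarrow> P (R_op q A)"
    and q: "q \<in> X - gen_kato_S_spectrum A"
  shows "sphere_isolated_in q X"
proof -
  have kato: "kato_type (R_op q A)" using q by (simp add: gen_kato_S_spectrum_def)
  obtain U where U: "open U" "qsphere q \<subseteq> U" "\<And>p. p \<in> U - qsphere q \<Longrightarrow> semi_regular (R_op p A)"
    using kato_type_imp_punctured_semi_regular[OF A kato] by blast
  have qX: "q \<in> X" using q by (rule DiffD1)
  have X_iff: "p \<in> X \<longleftrightarrow> \<not> P (R_op p A)" for p unfolding X by (rule mem_Collect_eq)
  have "p \<in> X" if "p \<in> qsphere q" for p using qX unfolding X_iff R_op_qsphere[OF that] .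
  moreover have "p \<in> qsphere q" if p: "p \<in> U \<inter> X" for p
  proof (rule ccontr)
    assume "p \<notin> qsphere q"
    then have "p \<in> U - qsphere q" using p by blast
    from reg[OF U(3)[OF this]] show False using p X_iff by blast
  qed
  ultimately have "U \<inter> X = qsphere q" using U(2) by blast
  then show ?thesis using qX U(1) unfolding sphere_isolated_in_def by blast
qed

lemma qsphere_eq: "p \<in> qsphere q \<Longrightarrow> qsphere p = qsphere q"
  by (simp add: qsphere_def)

text \<open>A basic open set that meets \<open>X\<close> inside a single sphere determines this sphere.\<close>

lemma countable_isolated_spheres:
  assumes iso: "\<And>q. q \<in> Y \<Longrightarrow> sphere_isolated_in q X"
  shows "countable (qsphere ` Y)"
proof -
  obtain \<B> :: "quat set set" where \<B>: "countable \<B>" "topological_basis \<B>"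
    using ex_countable_basis by blast
  have "\<exists>b\<in>\<B>. q \<in> b \<and> b \<inter> X \<subseteq> qsphere q" if q: "q \<in> Y" for q
  proof -
    obtain U where U: "open U" "U \<inter> X = qsphere q"
      using iso[OF q] unfolding sphere_isolated_in_def by blast
    then have "q \<in> U" using qsphere_self by blast
    then obtain b where "b \<in> \<B>" "q \<in> b" "b \<subseteq> U"
      using topological_basisE[OF \<B>(2) U(1)] by blast
    then show ?thesis using U(2) by blast
  qed
  then obtain b where b: "\<And>q. q \<in> Y \<Longrightarrow> b q \<in> \<B> \<and> q \<in> b q \<and> b q \<inter> X \<subseteq> qsphere q" by metis
  have YX: "Y \<subseteq> X" using iso by (auto simp: sphere_isolated_in_def)
  have "countable (b ` Y)" using b by (intro countable_subset[OF _ \<B>(1)]) blast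
  moreover have "qsphere q = qsphere (inv_into Y b (b q))" if q: "q \<in> Y" for q
  proof -
    define p where "p = inv_into Y b (b q)"
    have p: "p \<in> Y" "b p = b q" using q by (auto simp: p_def inv_into_into f_inv_into_f)
    then have "q \<in> qsphere p" using b q YX by blast
    then show ?thesis by (simp add: qsphere_eq p_def)
  qed
  then have "qsphere ` Y = (\<lambda>c. qsphere (inv_into Y b c)) ` b ` Y" by (simp add: image_image cong: image_cong)
  ultimately show ?thesis by simp
qed

theorem corollary8p12:
  fixes A :: "'a::right_quat_hilbert \<Rightarrow> 'a"
  assumes "bounded_right_linear A"
  shows "compact (gen_kato_S_spectrum A) \<and> gen_kato_S_spectrum A \<subseteq> S_spectrum A \<and>
    compact (ess_semi_regular_S_spectrum A) \<and> ess_semi_regular_S_spectrum A \<subseteq> S_spectrum A \<and>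
    countable (qsphere ` (kato_S_spectrum A - gen_kato_S_spectrum A)) \<and>
    (\<forall>q \<in> kato_S_spectrum A - gen_kato_S_spectrum A. sphere_isolated_in q (kato_S_spectrum A)) \<and>
    countable (qsphere ` (ess_semi_regular_S_spectrum A - gen_kato_S_spectrum A)) \<and>
    (\<forall>q \<in> ess_semi_regular_S_spectrum A - gen_kato_S_spectrum A.
       sphere_isolated_in q (ess_semi_regular_S_spectrum A))"
proof -
  have A: "bounded_linear A" using assms by (simp add: bounded_right_linear_def)
  have kato: "semi_regular (R_op q A) \<Longrightarrow> kato_type (R_op q A)"
    and ess: "semi_regular (R_op q A) \<Longrightarrow> essentially_semi_regular (R_op q A)"
    and ess_kato: "essentially_semi_regular (R_op q A) \<Longrightarrow> kato_type (R_op q A)" for q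
    using semi_regular_imp_kato_type semi_regular_imp_essentially_semi_regular
      essentially_semi_regular_imp_kato_type bounded_linear_R_op[OF A] R_op_0[OF A] by blast+
  note sub = gen_kato_subset_ess[OF A] ess_subset_kato[OF A] kato_S_spectrum_subset_S_spectrum[OF A]
  have bdd: "bounded (ess_semi_regular_S_spectrum A)" "bounded (gen_kato_S_spectrum A)"
    using bounded_kato_S_spectrum[OF A] sub by (meson bounded_subset)+
  have "closed (gen_kato_S_spectrum A)" "closed (ess_semi_regular_S_spectrum A)"
    by (rule closed_if_between_semi_regular_and_kato_type[OF A gen_kato_S_spectrum_def _ kato]
        closed_if_between_semi_regular_and_kato_type[OF A ess_semi_regular_S_spectrum_def ess_kato ess];
        assumption)+
  then have "compact (gen_kato_S_spectrum A)" "compact (ess_semi_regular_S_spectrum A)"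
    using bdd by (simp_all add: compact_eq_bounded_closed)
  moreover have iso_kato: "sphere_isolated_in q (kato_S_spectrum A)"
    if "q \<in> kato_S_spectrum A - gen_kato_S_spectrum A" for q
    using isolated_off_gen_kato_S_spectrum[OF A kato_S_spectrum_def _ that] .
  moreover have iso_ess: "sphere_isolated_in q (ess_semi_regular_S_spectrum A)"
    if "q \<in> ess_semi_regular_S_spectrum A - gen_kato_S_spectrum A" for q
    using isolated_off_gen_kato_S_spectrum[OF A ess_semi_regular_S_spectrum_def ess that] .
  moreover have "countable (qsphere ` (kato_S_spectrum A - gen_kato_S_spectrum A))"
    by (rule countable_isolated_spheres[OF iso_kato])
  moreover have "countable (qsphere ` (ess_semi_regular_S_spectrum A - gen_kato_S_spectrum A))"
    by (rule countable_isolated_spheres[OF iso_ess])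
  ultimately show ?thesis using sub by blast
qed

end
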